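(* Let $M$ be the McLain group of a non-empty totally ordered set $(\Lambda,\leq)$ over a ring $R$ with $1\neq0$, let $F$ be a field such that $R$ admits a right primitive linear character $R^+\to F^*$, let $D$ be a basic subset of $\Phi$ and $f$ a function from $D$ into the set of right primitive linear characters $R^+\to F^*$. With $H\leq M$ and the $1$-dimensional $H$-module $W$ associated to $(D,f)$ as in the context, $$V(D,f)\cong\mathrm{ind}_H^MW$$ as $M$-modules.
   Context: Modules are over the field $F$ and may be infinite dimensional; $\mathrm{ind}_H^GW=FG\otimes_{FH}W$. $R$ and $\Lambda$ may be infinite and $R$ need not be commutative. McLain group: $\Phi=\{(\alpha,\beta)\in\Lambda\times\Lambda:\alpha<\beta\}$. $J$ is the free left $R$-module with basis $e_{\alpha\beta}$, $(\alpha,\beta)\in\Phi$, made into a ring by $(re_{\alpha\beta})(se_{\beta\gamma})=rs\,e_{\alpha\gamma}$ and $(re_{\alpha\beta})(se_{\gamma\delta})=0$ if $\beta\neq\gamma$, extended additively. $J$ is nil, and $M=\{1+x:x\in J\}$ is a group under multiplication. $M_{\alpha\beta}=\{1+re_{\alpha\beta}:r\in R\}$. A subset $\Delta\subseteq\Phi$ is closed if $(\alpha,\beta),(\beta,\gamma)\in\Delta$ implies $(\alpha,\gamma)\in\Delta$; then $M(\Delta)=\langle M_{\alpha\beta}:(\alpha,\beta)\in\Delta\rangle$. A group homomorphism $R^+\to F^*$ (linear character) is right primitive if the only right ideal of $R$ contained in its kernel is $(0)$. Elementary modules: let $(\alpha,\beta)\in\Phi$ and let $\mu:R^+\to F^*$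 be right primitive. Let $L$ be the subgroup generated by all $M_{\gamma\delta}$ with $\alpha\le\gamma<\delta\le\beta$; let $P$ be the subgroup of $L$ generated by all $M_{\gamma\beta}$ with $\alpha\le\gamma<\beta$ and all $M_{\gamma\delta}$ with $\alpha<\gamma<\delta<\beta$. There is a $1$-dimensional $P$-module on which $1+re_{\alpha\beta}$ acts as $\mu(r)$ and all the other listed generators act trivially; $V(\alpha,\beta,\mu)$ is the $L$-module induced from it, viewed as an $M$-module through $M=N\rtimes L$, where $N$ is the normal subgroup generated by all $M_{\gamma\delta}$ with $\gamma<\alpha$ or $\delta>\beta$, and $N$ acts trivially. Basic modules: a finite non-empty subset $D=\{(\alpha_1,\beta_1),\dots,(\alpha_m,\beta_m)\}$ of $\Phi$ is basic if the $\alpha_i$ are distinct and the $\beta_i$ are distinct. Write $f(\alpha_i,\beta_i)=\lambda_i$. The basic $M$-module is $V(D,f)=V(\alpha_m,\beta_m,\lambda_m)\otimes_F\cdots\otimes_FV(\alpha_1,\beta_1,\lambda_1)$ with diagonal action. Notation attached to $(D,f)$: $\Gamma=\Phi\setminus\bigcup_i\{(\alpha_i,\gamma)\in\Phi:\gamma<\beta_i\}$ and $H=M(\Gamma)$. For each $i$, $H_i=M(\Phi\setminus\{(\alpha_i,\gamma)\in\Phi:\gamma<\beta_i\})$ and $\widehat{\lambda_i}:H_i\to F^*$ is the homomorphism with $1+re_{\alpha_i\beta_i}\mapsto\lambda_i(r)$ that is trivial on all $M_{\alpha\beta}$ with $(\alpha,\beta)\in\Phi\setminus\{(\alpha_i,\gamma)\in\Phi:\gamma\le\beta_i\}$.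 Then $H=\bigcap_iH_i$, $\lambda=\widehat{\lambda_1}|_H\cdots\widehat{\lambda_m}|_H$, and $W=Fw$ is the $1$-dimensional $H$-module on which $H$ acts via $\lambda$. *)

theory Defs
  imports "HOL-Algebra.Algebra" "HOL-Algebra.Algebraic_Closure_Type" "HOL-Library.Poly_Mapping"
begin

section \<open>Linear characters\<close>

abbreviation Ring :: "'a::ring_1 ring" where
  "Ring \<equiv> ring_of_type_algebra"

definition right_ideal :: "'r::ring_1 set \<Rightarrow> bool" where
  "right_ideal I \<longleftrightarrow> additive_subgroup I (Ring :: 'r ring) \<and> (\<forall>x\<in>I. \<forall>r. x * r \<in> I)"

definition linear_character :: "('r::ring_1 \<Rightarrow> 'f::field) \<Rightarrow> bool" where
  "linear_character \<mu> \<longleftrightarrow> \<mu> \<in> hom (add_monoid (Ring :: 'r ring)) (mult_of (Ring :: 'f ring))"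

definition right_primitive :: "('r::ring_1 \<Rightarrow> 'f::field) \<Rightarrow> bool" where
  "right_primitive \<mu> \<longleftrightarrow> linear_character \<mu> \<and>
     (\<forall>I. right_ideal I \<and> I \<subseteq> kernel (add_monoid (Ring :: 'r ring)) (mult_of (Ring :: 'f ring)) \<mu>
        \<longrightarrow> I = {0})"


section \<open>The McLain group\<close>

definition Phi :: "('l::linorder \<times> 'l) set" where
  "Phi = {(\<alpha>, \<beta>). \<alpha> < \<beta>}"

text \<open>The free left \<open>R\<close>-module with basis \<open>e\<^sub>d\<close>, \<open>d \<in> Phi\<close>; here \<open>r e\<^sub>d\<close> is
  \<^term>\<open>Poly_Mapping.single d r\<close>. Its product is \<open>jmult\<close>, not the convolution product
  that the library puts on \<^type>\<open>poly_mapping\<close>.\<close>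

definition J :: "('l::linorder \<times> 'l \<Rightarrow>\<^sub>0 'r::ring_1) set" where
  "J = {x. Poly_Mapping.keys x \<subseteq> Phi}"

definition jmult :: "('l \<times> 'l \<Rightarrow>\<^sub>0 'r::ring_1) \<Rightarrow> ('l \<times> 'l \<Rightarrow>\<^sub>0 'r) \<Rightarrow> ('l \<times> 'l \<Rightarrow>\<^sub>0 'r)" where
  "jmult x y = (\<Sum>p\<in>Poly_Mapping.keys x. \<Sum>q\<in>Poly_Mapping.keys y.
     if snd p = fst q
     then Poly_Mapping.single (fst p, snd q) (Poly_Mapping.lookup x p * Poly_Mapping.lookup y q)
     else 0)"

text \<open>The element \<open>1 + x\<close> of the McLain group is represented by \<open>x \<in> J\<close>, so the product is
  read off from \<open>(1 + x)(1 + y) = 1 + (x + y + xy)\<close>.\<close>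

definition McLain :: "('l::linorder \<times> 'l \<Rightarrow>\<^sub>0 'r::ring_1) monoid" where
  "McLain = \<lparr>carrier = J, monoid.mult = (\<lambda>x y. x + y + jmult x y), one = 0\<rparr>"

definition root_elt :: "'l \<times> 'l \<Rightarrow> 'r::ring_1 \<Rightarrow> ('l \<times> 'l \<Rightarrow>\<^sub>0 'r)" where
  "root_elt d r = Poly_Mapping.single d r"

definition root_subgroup :: "'l \<times> 'l \<Rightarrow> ('l \<times> 'l \<Rightarrow>\<^sub>0 'r::ring_1) set" where
  "root_subgroup d = range (root_elt d)"

definition M_of :: "('l::linorder \<times> 'l) set \<Rightarrow> ('l \<times> 'l \<Rightarrow>\<^sub>0 'r::ring_1) set" where
  "M_of \<Delta> = generate McLain (\<Union>d\<in>\<Delta>. root_subgroup d)"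

definition normal_closure :: "('g, 'k) monoid_scheme \<Rightarrow> 'g set \<Rightarrow> 'g set" where
  "normal_closure G S = \<Inter>{N. N \<lhd> G \<and> S \<subseteq> N}"

text \<open>The homomorphism \<open>M(\<Delta>) \<rightarrow> F\<^sup>*\<close> with \<open>1 + r e\<^sub>d \<mapsto> \<mu> r\<close> that is trivial on the other
  \<open>M\<^sub>c\<close>, \<open>c \<in> \<Delta>\<close>. Extensionality makes it unique as a function on the whole type.\<close>

definition root_character ::
    "('l::linorder \<times> 'l) set \<Rightarrow> 'l \<times> 'l \<Rightarrow> ('r::ring_1 \<Rightarrow> 'f::field) \<Rightarrow> ('l \<times> 'l \<Rightarrow>\<^sub>0 'r) \<Rightarrow> 'f" where
  "root_character \<Delta> d \<mu> = (THE \<chi>.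
     \<chi> \<in> hom (McLain\<lparr>carrier := M_of \<Delta>\<rparr>) (mult_of (Ring :: 'f ring)) \<and>
     \<chi> \<in> extensional (M_of \<Delta>) \<and>
     (\<forall>r. \<chi> (root_elt d r) = \<mu> r) \<and>
     (\<forall>c\<in>\<Delta> - {d}. \<forall>r. \<chi> (root_elt c r) = 1))"


section \<open>Modules for a group over a field\<close>

record ('g, 'f, 'v) gspace = "('f, 'v) module" +
  act :: "'g \<Rightarrow> 'v \<Rightarrow> 'v"

locale gmodule = G: group G + Module.module "Ring :: 'f::field ring" V
  for G :: "('g, 'k) monoid_scheme" and V :: "('g, 'f::field, 'v) gspace" +
  assumes act_closed: "g \<in> carrier G \<Longrightarrow> v \<in> carrier V \<Longrightarrow> act V g v \<in> carrier V"
    and act_one: "v \<in> carrier V \<Longrightarrow> act V \<one>\<^bsub>G\<^esub> v = v"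
    and act_mult: "g \<in> carrier G \<Longrightarrow> h \<in> carrier G \<Longrightarrow> v \<in> carrier V \<Longrightarrow>
      act V (g \<otimes>\<^bsub>G\<^esub> h) v = act V g (act V h v)"
    and act_add: "g \<in> carrier G \<Longrightarrow> v \<in> carrier V \<Longrightarrow> w \<in> carrier V \<Longrightarrow>
      act V g (v \<oplus>\<^bsub>V\<^esub> w) = act V g v \<oplus>\<^bsub>V\<^esub> act V g w"
    and act_smult: "g \<in> carrier G \<Longrightarrow> v \<in> carrier V \<Longrightarrow>
      act V g (c \<odot>\<^bsub>V\<^esub> v) = c \<odot>\<^bsub>V\<^esub> act V g v"

definition gmodule_iso ::
    "('g, 'k) monoid_scheme \<Rightarrow> ('g, 'f::field, 'v) gspace \<Rightarrow> ('g, 'f, 'w) gspace \<Rightarrow> bool" where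
  "gmodule_iso G V W \<longleftrightarrow> gmodule G V \<and> gmodule G W \<and>
     (\<exists>\<phi>. bij_betw \<phi> (carrier V) (carrier W) \<and>
       (\<forall>v\<in>carrier V. \<forall>v'\<in>carrier V. \<phi> (v \<oplus>\<^bsub>V\<^esub> v') = \<phi> v \<oplus>\<^bsub>W\<^esub> \<phi> v') \<and>
       (\<forall>c. \<forall>v\<in>carrier V. \<phi> (c \<odot>\<^bsub>V\<^esub> v) = c \<odot>\<^bsub>W\<^esub> \<phi> v) \<and>
       (\<forall>g\<in>carrier G. \<forall>v\<in>carrier V. \<phi> (act V g v) = act W g (\<phi> v)))"

definition char_module :: "('g \<Rightarrow> 'f::field) \<Rightarrow> ('g, 'f, 'f) gspace" where
  "char_module \<chi> = \<lparr>carrier = UNIV, monoid.mult = undefined, one = undefined,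
     ring.zero = 0, add = (+), module.smult = (*), act = (\<lambda>g v. \<chi> g * v)\<rparr>"


subsection \<open>Free vector spaces and their quotients\<close>

definition scale :: "'f::field \<Rightarrow> ('x \<Rightarrow>\<^sub>0 'f) \<Rightarrow> ('x \<Rightarrow>\<^sub>0 'f)" where
  "scale c p = Poly_Mapping.map ((*) c) p"

lemma lookup_scale: "Poly_Mapping.lookup (scale c p) x = c * Poly_Mapping.lookup p x"
  by (auto simp: scale_def Poly_Mapping.map.rep_eq when_def)

interpretation free: vector_space scale
  by standard (auto intro!: poly_mapping_eqI simp: lookup_scale lookup_add algebra_simps)

definition basis_elt :: "'x \<Rightarrow> ('x \<Rightarrow>\<^sub>0 'f::field)" where
  "basis_elt x = Poly_Mapping.single x 1"

definition lin_ext :: "('x \<Rightarrow> 'x) \<Rightarrow> ('x \<Rightarrow>\<^sub>0 'f::field) \<Rightarrow> ('x \<Rightarrow>\<^sub>0 'f)" where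
  "lin_ext b p = (\<Sum>x\<in>Poly_Mapping.keys p. scale (Poly_Mapping.lookup p x) (basis_elt (b x)))"

text \<open>The quotient of the free \<open>F\<close>-space on \<open>B\<close> by the span of a subset \<open>T\<close> of it; the
  elements are cosets, and \<open>g\<close> acts as the linear extension of the map \<open>b g\<close> of \<open>B\<close> into
  itself, which must preserve the span of \<open>T\<close>. The unions over the representatives of a coset
  are then unions of equal cosets.\<close>

definition coset :: "('x \<Rightarrow>\<^sub>0 'f::field) set \<Rightarrow> ('x \<Rightarrow>\<^sub>0 'f) \<Rightarrow> ('x \<Rightarrow>\<^sub>0 'f) set" where
  "coset T p = (+) p ` free.span T"

definition free_quotient ::
    "'x set \<Rightarrow> ('x \<Rightarrow>\<^sub>0 'f::field) set \<Rightarrow> ('g \<Rightarrow> 'x \<Rightarrow> 'x) \<Rightarrow> ('g, 'f, ('x \<Rightarrow>\<^sub>0 'f) set) gspace" where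
  "free_quotient B T b = \<lparr>
     carrier = coset T ` {p. Poly_Mapping.keys p \<subseteq> B},
     monoid.mult = undefined, one = undefined,
     ring.zero = free.span T,
     add = (\<lambda>A A'. {p + q | p q. p \<in> A \<and> q \<in> A'}),
     module.smult = (\<lambda>c A. \<Union>p\<in>A. coset T (scale c p)),
     act = (\<lambda>g A. \<Union>p\<in>A. coset T (lin_ext (b g) p))\<rparr>"


subsection \<open>Induced modules\<close>

text \<open>The group algebra of a subgroup \<open>H\<close> of \<open>G\<close>, as a subset of that of \<open>G\<close>, with convolution
  as product.\<close>

definition galg :: "'g set \<Rightarrow> ('g \<Rightarrow>\<^sub>0 'f::field) set" where
  "galg H = {a. Poly_Mapping.keys a \<subseteq> H}"

definition galg_mult ::
    "('g, 'k) monoid_scheme \<Rightarrow> ('g \<Rightarrow>\<^sub>0 'f::field) \<Rightarrow> ('g \<Rightarrow>\<^sub>0 'f) \<Rightarrow> ('g \<Rightarrow>\<^sub>0 'f)" where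
  "galg_mult G a b = (\<Sum>g\<in>Poly_Mapping.keys a. \<Sum>h\<in>Poly_Mapping.keys b.
     Poly_Mapping.single (g \<otimes>\<^bsub>G\<^esub> h) (Poly_Mapping.lookup a g * Poly_Mapping.lookup b h))"

definition galg_act :: "('g, 'f::field, 'w) gspace \<Rightarrow> ('g \<Rightarrow>\<^sub>0 'f) \<Rightarrow> 'w \<Rightarrow> 'w" where
  "galg_act W a w =
     (\<Oplus>\<^bsub>W\<^esub>h\<in>Poly_Mapping.keys a. Poly_Mapping.lookup a h \<odot>\<^bsub>W\<^esub> act W h w)"

text \<open>\<open>ind\<^sub>H\<^sup>G W\<close> is \<open>FG \<otimes>\<^sub>F\<^sub>H W\<close>: the free \<open>F\<close>-space on \<open>FG \<times> W\<close>
  modulo biadditivity, \<open>(c x, w) = c (x, w)\<close> for \<open>c \<in> F\<close>, and \<open>(x a, w) = (x, a w)\<close> for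
  \<open>a \<in> FH\<close>; \<open>g \<in> G\<close> acts by left multiplication on \<open>FG\<close>.\<close>

definition ind_relations ::
    "('g, 'k) monoid_scheme \<Rightarrow> 'g set \<Rightarrow> ('g, 'f::field, 'w) gspace \<Rightarrow>
     (('g \<Rightarrow>\<^sub>0 'f) \<times> 'w \<Rightarrow>\<^sub>0 'f) set" where
  "ind_relations G H W =
     {basis_elt (x + y, w) - basis_elt (x, w) - basis_elt (y, w) | x y w.
        x \<in> galg (carrier G) \<and> y \<in> galg (carrier G) \<and> w \<in> carrier W} \<union>
     {basis_elt (x, v \<oplus>\<^bsub>W\<^esub> w) - basis_elt (x, v) - basis_elt (x, w) | x v w.
        x \<in> galg (carrier G) \<and> v \<in> carrier W \<and> w \<in> carrier W} \<union>
     {basis_elt (scale c x, w) - scale c (basis_elt (x, w)) | c x w.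
        x \<in> galg (carrier G) \<and> w \<in> carrier W} \<union>
     {basis_elt (galg_mult G x a, w) - basis_elt (x, galg_act W a w) | x a w.
        x \<in> galg (carrier G) \<and> a \<in> galg H \<and> w \<in> carrier W}"

definition ind ::
    "('g, 'k) monoid_scheme \<Rightarrow> 'g set \<Rightarrow> ('g, 'f::field, 'w) gspace \<Rightarrow>
     ('g, 'f, (('g \<Rightarrow>\<^sub>0 'f) \<times> 'w \<Rightarrow>\<^sub>0 'f) set) gspace" where
  "ind G H W = free_quotient (galg (carrier G) \<times> carrier W) (ind_relations G H W)
     (\<lambda>g (x, w). (galg_mult G (basis_elt g) x, w))"


subsection \<open>Tensor products over the field\<close>

text \<open>The tensor product over \<open>F\<close> of a finite family of \<open>G\<close>-modules, with diagonal action: the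
  free \<open>F\<close>-space on the product of the family modulo the multilinearity relations.\<close>

definition tensor_relations ::
    "'i set \<Rightarrow> ('i \<Rightarrow> ('g, 'f::field, 'v) gspace) \<Rightarrow> (('i \<Rightarrow> 'v) \<Rightarrow>\<^sub>0 'f) set" where
  "tensor_relations I V =
     {basis_elt (u(i := x \<oplus>\<^bsub>V i\<^esub> y)) - basis_elt (u(i := x)) - basis_elt (u(i := y)) | u i x y.
        u \<in> (\<Pi>\<^sub>E j\<in>I. carrier (V j)) \<and> i \<in> I \<and> x \<in> carrier (V i) \<and> y \<in> carrier (V i)} \<union>
     {basis_elt (u(i := c \<odot>\<^bsub>V i\<^esub> x)) - scale c (basis_elt (u(i := x))) | u i c x.
        u \<in> (\<Pi>\<^sub>E j\<in>I. carrier (V j)) \<and> i \<in> I \<and> x \<in> carrier (V i)}"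

definition tensor ::
    "'i set \<Rightarrow> ('i \<Rightarrow> ('g, 'f::field, 'v) gspace) \<Rightarrow>
     ('g, 'f, (('i \<Rightarrow> 'v) \<Rightarrow>\<^sub>0 'f) set) gspace" where
  "tensor I V = free_quotient (\<Pi>\<^sub>E i\<in>I. carrier (V i)) (tensor_relations I V)
     (\<lambda>g u. \<lambda>i\<in>I. act (V i) g (u i))"


section \<open>Elementary and basic modules\<close>

text \<open>A module for the complement \<open>L\<close> in \<open>G = N \<rtimes> L\<close>, viewed as a \<open>G\<close>-module.\<close>

definition inflate ::
    "('g, 'k) monoid_scheme \<Rightarrow> 'g set \<Rightarrow> 'g set \<Rightarrow> ('g, 'f, 'v) gspace \<Rightarrow> ('g, 'f, 'v) gspace" where
  "inflate G N L V = V\<lparr>act := (\<lambda>g. act V (THE l. l \<in> L \<and> (\<exists>n\<in>N. g = n \<otimes>\<^bsub>G\<^esub> l)))\<rparr>"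

definition L_roots :: "'l::linorder \<times> 'l \<Rightarrow> ('l \<times> 'l) set" where
  "L_roots = (\<lambda>(\<alpha>, \<beta>). {(\<gamma>, \<delta>). \<alpha> \<le> \<gamma> \<and> \<gamma> < \<delta> \<and> \<delta> \<le> \<beta>})"

definition P_roots :: "'l::linorder \<times> 'l \<Rightarrow> ('l \<times> 'l) set" where
  "P_roots = (\<lambda>(\<alpha>, \<beta>). {(\<gamma>, \<delta>). \<alpha> \<le> \<gamma> \<and> \<gamma> < \<beta> \<and> \<delta> = \<beta>}
     \<union> {(\<gamma>, \<delta>). \<alpha> < \<gamma> \<and> \<gamma> < \<delta> \<and> \<delta> < \<beta>})"

definition N_roots :: "'l::linorder \<times> 'l \<Rightarrow> ('l \<times> 'l) set" where
  "N_roots = (\<lambda>(\<alpha>, \<beta>). {(\<gamma>, \<delta>) \<in> Phi. \<gamma> < \<alpha> \<or> \<delta> > \<beta>})"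

type_synonym ('l, 'r, 'f) elementary_carrier =
  "((('l \<times> 'l \<Rightarrow>\<^sub>0 'r) \<Rightarrow>\<^sub>0 'f) \<times> 'f \<Rightarrow>\<^sub>0 'f) set"

definition elementary_module ::
    "'l::linorder \<times> 'l \<Rightarrow> ('r::ring_1 \<Rightarrow> 'f::field) \<Rightarrow>
     ('l \<times> 'l \<Rightarrow>\<^sub>0 'r, 'f, ('l, 'r, 'f) elementary_carrier) gspace" where
  "elementary_module d \<mu> =
     inflate McLain (normal_closure McLain (\<Union>c\<in>N_roots d. root_subgroup c)) (M_of (L_roots d))
       (ind (McLain\<lparr>carrier := M_of (L_roots d)\<rparr>) (M_of (P_roots d))
          (char_module (root_character (P_roots d) d \<mu>)))"

definition basic :: "('l::linorder \<times> 'l) set \<Rightarrow> bool" where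
  "basic D \<longleftrightarrow> finite D \<and> D \<noteq> {} \<and> D \<subseteq> Phi \<and> inj_on fst D \<and> inj_on snd D"

definition basic_module ::
    "('l::linorder \<times> 'l) set \<Rightarrow> ('l \<times> 'l \<Rightarrow> 'r::ring_1 \<Rightarrow> 'f::field) \<Rightarrow>
     ('l \<times> 'l \<Rightarrow>\<^sub>0 'r, 'f,
       (('l \<times> 'l \<Rightarrow> ('l, 'r, 'f) elementary_carrier) \<Rightarrow>\<^sub>0 'f) set) gspace" where
  "basic_module D f = tensor D (\<lambda>d. elementary_module d (f d))"


section \<open>The inducing subgroup and its character\<close>

definition removed_roots :: "'l::linorder \<times> 'l \<Rightarrow> ('l \<times> 'l) set" where
  "removed_roots = (\<lambda>(\<alpha>, \<beta>). {(\<alpha>', \<gamma>) \<in> Phi. \<alpha>' = \<alpha> \<and> \<gamma> < \<beta>})"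

definition Gamma :: "('l::linorder \<times> 'l) set \<Rightarrow> ('l \<times> 'l) set" where
  "Gamma D = Phi - (\<Union>d\<in>D. removed_roots d)"

definition hat :: "'l::linorder \<times> 'l \<Rightarrow> ('r::ring_1 \<Rightarrow> 'f::field) \<Rightarrow> ('l \<times> 'l \<Rightarrow>\<^sub>0 'r) \<Rightarrow> 'f" where
  "hat d \<mu> = root_character (Phi - removed_roots d) d \<mu>"

definition W_module ::
    "('l::linorder \<times> 'l) set \<Rightarrow> ('l \<times> 'l \<Rightarrow> 'r::ring_1 \<Rightarrow> 'f::field) \<Rightarrow>
     ('l \<times> 'l \<Rightarrow>\<^sub>0 'r, 'f, 'f) gspace" where
  "W_module D f = char_module (\<lambda>h. \<Prod>d\<in>D. hat d (f d) h)"

end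

theory Submission
  imports Defs
begin

text \<open>An element of \<open>ind\<^sub>H\<^sup>M W\<close> is viewed as a function \<open>\<phi>\<close> on \<open>M\<close> with
  \<open>\<phi>(h x) = \<lambda>(h) \<phi>(x)\<close> for \<open>h \<in> H\<close>, on which \<open>M\<close> acts by right translation: \<open>g \<otimes> w\<close> is
  supported on \<open>H g\<inverse>\<close>. An elementary module \<open>V(\<alpha>\<^sub>i, \<beta>\<^sub>i, \<lambda>\<^sub>i)\<close> becomes in the same way the space of
  functions attached to \<open>H\<^sub>i\<close>, and the right coset \<open>H\<^sub>i x\<close> is determined by the entries of row \<open>\<alpha>\<^sub>i\<close> of
  \<open>x\<close> to the left of column \<open>\<beta>\<^sub>i\<close>. The tensor product is realized by pointwise multiplication of functions.
  As the \<open>\<alpha>\<^sub>i\<close> are distinct, the truncated rows can be prescribed independently, so every family of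
  cosets of the \<open>H\<^sub>i\<close> meets in exactly one coset of \<open>H = \<Inter>\<^sub>i H\<^sub>i\<close>; hence the basis of the tensor product
  is carried bijectively onto the basis of \<open>ind\<^sub>H\<^sup>M W\<close>.\<close>

subsection \<open>The McLain group\<close>

text \<open>Evaluation at group elements serves instead: it kills the defining relations, and a
  spanning family of vectors that is dual to some of the points shows that it kills nothing else. An
  isomorphism then amounts to an equality of functions on M, checked on basis vectors. A
  correspondence of cosets alone would match these functions only up to nonzero scalars. The scalars
  are 1 for a particular choice of representatives, those with entries in the truncated rows only.
  If y is such a representative of a coset of H and y_i is its i-th truncated row, then y y_i^{-1}
  lies in H_i and its entry at (\<alpha>_i, \<beta>_i) is 0, because neither y nor y_i has an entry
  there; hence the i-th character is 1 on it. That y has no entry there rests once more on the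
  \<alpha>_i being distinct.\<close>

definition supported :: "('l \<times> 'l) set \<Rightarrow> ('l \<times> 'l \<Rightarrow>\<^sub>0 'r::ring_1) set" where
  "supported \<Delta> = {x. Poly_Mapping.keys x \<subseteq> \<Delta>}"

definition closed_roots :: "('l \<times> 'l) set \<Rightarrow> bool" where
  "closed_roots \<Delta> \<longleftrightarrow> (\<forall>a b c. (a, b) \<in> \<Delta> \<longrightarrow> (b, c) \<in> \<Delta> \<longrightarrow> (a, c) \<in> \<Delta>)"

text \<open>Serves to delete one root in an induction, to project M onto the complement L, and to
  pick coset representatives that live in the truncated rows.\<close>

definition restr :: "'x set \<Rightarrow> ('x \<Rightarrow>\<^sub>0 'a::comm_monoid_add) \<Rightarrow> ('x \<Rightarrow>\<^sub>0 'a)" where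
  "restr S x = (\<Sum>k\<in>Poly_Mapping.keys x \<inter> S. Poly_Mapping.single k (Poly_Mapping.lookup x k))"

lemma lookup_restr:
  "Poly_Mapping.lookup (restr S x) k = (if k \<in> S then Poly_Mapping.lookup x k else 0)"
proof -
  have "Poly_Mapping.lookup (restr S x) k =
      (\<Sum>j\<in>Poly_Mapping.keys x \<inter> S. if j = k then Poly_Mapping.lookup x j else 0)"
    by (simp add: restr_def lookup_sum lookup_single when_def)
  then show ?thesis
    by (auto simp: sum.delta' in_keys_iff)
qed

lemma keys_restr: "Poly_Mapping.keys (restr S x) = Poly_Mapping.keys x \<inter> S"
  by (auto simp: in_keys_iff lookup_restr split: if_splits)

lemma supported_iff: "x \<in> supported \<Delta> \<longleftrightarrow> (\<forall>k. k \<notin> \<Delta> \<longrightarrow> Poly_Mapping.lookup x k = 0)"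
  by (auto simp: supported_def in_keys_iff)

lemma supportedD: "x \<in> supported \<Delta> \<Longrightarrow> k \<notin> \<Delta> \<Longrightarrow> Poly_Mapping.lookup x k = 0"
  unfolding supported_iff by blast

lemma supported_mono: "\<Delta> \<subseteq> \<Delta>' \<Longrightarrow> supported \<Delta> \<subseteq> supported \<Delta>'"
  by (auto simp: supported_def)

lemma J_eq: "J = supported Phi"
  by (auto simp: J_def supported_def)

text \<open>The index set may be infinite, so the matrix product needs a finite range of summation.
  Any finite \<open>S\<close> containing the contributing middle indices is allowed, which lets
  several products be summed over one common set.\<close>

lemma lookup_jmult:
  assumes "finite S" "\<And>b. Poly_Mapping.lookup x (a, b) \<noteq> 0 \<Longrightarrow> Poly_Mapping.lookup y (b, c) \<noteq> 0 \<Longrightarrow> b \<in> S"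
  shows "Poly_Mapping.lookup (jmult x y) (a, c) =
    (\<Sum>b\<in>S. Poly_Mapping.lookup x (a, b) * Poly_Mapping.lookup y (b, c))"
proof -
  let ?x = "Poly_Mapping.lookup x" and ?y = "Poly_Mapping.lookup y"
  let ?K = "Poly_Mapping.keys x" and ?L = "Poly_Mapping.keys y"
  let ?g = "\<lambda>(p, q). if snd p = fst q \<and> fst p = a \<and> snd q = c then ?x p * ?y q else 0"
  let ?S = "{b \<in> S. (a, b) \<in> ?K \<and> (b, c) \<in> ?L}"
  have "Poly_Mapping.lookup (jmult x y) (a, c) =
      (\<Sum>p\<in>?K. \<Sum>q\<in>?L. if snd p = fst q \<and> fst p = a \<and> snd q = c then ?x p * ?y q else 0)"
    by (auto simp: jmult_def lookup_sum lookup_single when_def intro!: sum.cong)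
  also have "\<dots> = sum ?g (?K \<times> ?L)"
    by (simp add: sum.cartesian_product)
  \<comment> \<open>A summand at position (a, c) forces p = (a, b) and q = (b, c), so the middle
    index b alone parametrizes the surviving pairs.\<close>
  also have "\<dots> = sum ?g ((\<lambda>b. ((a, b), (b, c))) ` ?S)"
    using assms by (intro sum.mono_neutral_right) (auto simp: in_keys_iff image_iff)
  also have "\<dots> = (\<Sum>b\<in>?S. ?x (a, b) * ?y (b, c))"
    by (subst sum.reindex) (auto simp: inj_on_def)
  also have "\<dots> = (\<Sum>b\<in>S. ?x (a, b) * ?y (b, c))"
    using assms by (intro sum.mono_neutral_left) (auto simp: in_keys_iff)
  finally show ?thesis .
qed

lemma lookup_keys_image:
  "Poly_Mapping.lookup x (a, b) \<noteq> 0 \<Longrightarrow> a \<in> fst ` Poly_Mapping.keys x"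
  "Poly_Mapping.lookup x (a, b) \<noteq> 0 \<Longrightarrow> b \<in> snd ` Poly_Mapping.keys x"
  by (metis fst_conv snd_conv imageI in_keys_iff)+

abbreviation mmult :: "('l::linorder \<times> 'l \<Rightarrow>\<^sub>0 'r::ring_1) \<Rightarrow> ('l \<times> 'l \<Rightarrow>\<^sub>0 'r) \<Rightarrow> ('l \<times> 'l \<Rightarrow>\<^sub>0 'r)"
  (infixl \<open>\<star>\<close> 70) where "x \<star> y \<equiv> x \<otimes>\<^bsub>McLain\<^esub> y"

abbreviation minv :: "('l::linorder \<times> 'l \<Rightarrow>\<^sub>0 'r::ring_1) \<Rightarrow> ('l \<times> 'l \<Rightarrow>\<^sub>0 'r)"
  where "minv x \<equiv> inv\<^bsub>McLain\<^esub> x"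

lemma McLain_simps: "carrier McLain = supported Phi" "\<one>\<^bsub>McLain\<^esub> = 0" "x \<star> y = x + y + jmult x y"
  by (auto simp: McLain_def J_eq)

lemma lookup_mmult:
  assumes "finite S" "\<And>b. Poly_Mapping.lookup x (a, b) \<noteq> 0 \<Longrightarrow> Poly_Mapping.lookup y (b, c) \<noteq> 0 \<Longrightarrow> b \<in> S"
  shows "Poly_Mapping.lookup (x \<star> y) (a, c) = Poly_Mapping.lookup x (a, c) + Poly_Mapping.lookup y (a, c) +
    (\<Sum>b\<in>S. Poly_Mapping.lookup x (a, b) * Poly_Mapping.lookup y (b, c))"
  by (simp add: McLain_simps lookup_add lookup_jmult[OF assms])

lemma jmult_closed:
  assumes "closed_roots \<Delta>" "x \<in> supported \<Delta>" "y \<in> supported \<Delta>"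
  shows "jmult x y \<in> supported \<Delta>"
proof (unfold supported_iff, intro allI impI)
  fix k assume k: "k \<notin> \<Delta>"
  obtain a c where ac: "k = (a, c)" by (cases k)
  \<comment> \<open>At a position outside a closed set no middle index contributes, so the empty
    range is admissible.\<close>
  have "Poly_Mapping.lookup (jmult x y) (a, c) = (\<Sum>b\<in>{}. Poly_Mapping.lookup x (a, b) * Poly_Mapping.lookup y (b, c))"
  proof (rule lookup_jmult)
    fix b assume "Poly_Mapping.lookup x (a, b) \<noteq> 0" "Poly_Mapping.lookup y (b, c) \<noteq> 0"
    then have "(a, b) \<in> \<Delta>" "(b, c) \<in> \<Delta>" using assms supportedD by blast+
    then have "(a, c) \<in> \<Delta>" using assms(1) unfolding closed_roots_def by blast
    then show "b \<in> {}" using k ac by simp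
  qed simp
  then show "Poly_Mapping.lookup (jmult x y) k = 0" using ac by simp
qed

lemma mmult_closed:
  "closed_roots \<Delta> \<Longrightarrow> x \<in> supported \<Delta> \<Longrightarrow> y \<in> supported \<Delta> \<Longrightarrow> x \<star> y \<in> supported \<Delta>"
  using jmult_closed[of \<Delta> x y] by (auto simp: McLain_simps supported_iff lookup_add)

lemma jmult_add_left: "jmult (x + y) z = jmult x z + jmult y z"
proof (rule poly_mapping_eqI)
  fix k :: "'a \<times> 'a"
  obtain a c where [simp]: "k = (a, c)" by (cases k)
  show "Poly_Mapping.lookup (jmult (x + y) z) k = Poly_Mapping.lookup (jmult x z + jmult y z) k"
    by (simp add: lookup_add lookup_jmult[of "fst ` Poly_Mapping.keys z"] lookup_keys_image
        sum.distrib distrib_right)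
qed

lemma jmult_add_right: "jmult x (y + z) = jmult x y + jmult x z"
proof (rule poly_mapping_eqI)
  fix k :: "'a \<times> 'a"
  obtain a c where [simp]: "k = (a, c)" by (cases k)
  show "Poly_Mapping.lookup (jmult x (y + z)) k = Poly_Mapping.lookup (jmult x y + jmult x z) k"
    by (simp add: lookup_add lookup_jmult[of "snd ` Poly_Mapping.keys x"] lookup_keys_image
        sum.distrib distrib_left)
qed

lemma jmult_assoc: "jmult (jmult x y) z = jmult x (jmult y z)"
proof (rule poly_mapping_eqI)
  fix k :: "'a \<times> 'a"
  obtain a c where [simp]: "k = (a, c)" by (cases k)
  \<comment> \<open>Neither range depends on the other summation index, so the double sum can be
    swapped.\<close>
  let ?S = "snd ` Poly_Mapping.keys x" and ?T = "fst ` Poly_Mapping.keys z"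
  have 1: "Poly_Mapping.lookup (jmult x y) (a, b) =
      (\<Sum>e\<in>?S. Poly_Mapping.lookup x (a, e) * Poly_Mapping.lookup y (e, b))" for b
    by (rule lookup_jmult) (auto intro: lookup_keys_image)
  have 2: "Poly_Mapping.lookup (jmult y z) (e, c) =
      (\<Sum>b\<in>?T. Poly_Mapping.lookup y (e, b) * Poly_Mapping.lookup z (b, c))" for e
    by (rule lookup_jmult) (auto intro: lookup_keys_image)
  have "Poly_Mapping.lookup (jmult (jmult x y) z) k =
      (\<Sum>b\<in>?T. Poly_Mapping.lookup (jmult x y) (a, b) * Poly_Mapping.lookup z (b, c))"
    by simp (rule lookup_jmult; auto intro: lookup_keys_image)
  also have "\<dots> = (\<Sum>e\<in>?S. Poly_Mapping.lookup x (a, e) * Poly_Mapping.lookup (jmult y z) (e, c))"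
    by (simp add: 1 2 sum_distrib_left sum_distrib_right mult.assoc) (rule sum.swap)
  also have "\<dots> = Poly_Mapping.lookup (jmult x (jmult y z)) k"
    by simp (rule lookup_jmult[symmetric]; auto intro: lookup_keys_image)
  finally show "Poly_Mapping.lookup (jmult (jmult x y) z) k = Poly_Mapping.lookup (jmult x (jmult y z)) k" .
qed

lemma jmult_zero [simp]: "jmult 0 x = 0" "jmult x 0 = 0"
  by (simp_all add: jmult_def)

section \<open>The McLain group and the subgroups of closed root sets\<close>

lemma closed_Phi: "closed_roots (Phi :: ('l::linorder \<times> 'l) set)"
  by (auto simp: closed_roots_def Phi_def)

lemma monoid_McLain: "monoid (McLain :: ('l::linorder \<times> 'l \<Rightarrow>\<^sub>0 'r::ring_1) monoid)"
  by (rule monoidI)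
    (auto simp: McLain_simps(1,2) mmult_closed closed_Phi,
     auto simp: McLain_simps supported_iff jmult_add_left jmult_add_right jmult_assoc add_ac)

text \<open>Splitting off a root with minimal first index on the right creates no product terms.\<close>

lemma McLain_induct [consumes 2, case_names zero mult]:
  fixes x :: "'l::linorder \<times> 'l \<Rightarrow>\<^sub>0 'r::ring_1"
  assumes "x \<in> supported \<Delta>" "\<Delta> \<subseteq> Phi"
    and "P 0"
    and "\<And>y c r. y \<in> supported \<Delta> \<Longrightarrow> c \<in> \<Delta> \<Longrightarrow> P y \<Longrightarrow> P (y \<star> root_elt c r)"
  shows "P x"
  using assms(1)
proof (induction "card (Poly_Mapping.keys x)" arbitrary: x)
  case 0
  then show ?case using assms(3) by simp
next
  case (Suc n)
  let ?K = "Poly_Mapping.keys x"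
  have ne: "?K \<noteq> {}" "finite ?K" using Suc by auto
  define \<gamma> where "\<gamma> = Min (fst ` ?K)"
  have "\<gamma> \<in> fst ` ?K" unfolding \<gamma>_def using ne by (intro Min_in) auto
  then obtain \<delta> where c: "(\<gamma>, \<delta>) \<in> ?K" by auto
  have min: "\<gamma> \<le> a" if "(a, b) \<in> ?K" for a b
    unfolding \<gamma>_def using that ne by (intro Min_le) (auto intro: rev_image_eqI)
  define y where "y = restr (- {(\<gamma>, \<delta>)}) x"
  have ky: "Poly_Mapping.keys y = ?K - {(\<gamma>, \<delta>)}" by (auto simp: y_def keys_restr)
  have ys: "y \<in> supported \<Delta>" using Suc(3) ky by (auto simp: supported_def)
  have "jmult y (root_elt (\<gamma>, \<delta>) (Poly_Mapping.lookup x (\<gamma>, \<delta>))) = 0"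
  proof (rule poly_mapping_eqI)
    fix k :: "'l \<times> 'l"
    obtain a e where k: "k = (a, e)" by (cases k)
    \<comment> \<open>A product term would need an entry of \<open>y\<close> at some (a, \<gamma>)
      with a < \<gamma>, against the minimality of \<gamma>.\<close>
    have "Poly_Mapping.lookup y (a, \<gamma>) = 0"
    proof (rule ccontr)
      assume "Poly_Mapping.lookup y (a, \<gamma>) \<noteq> 0"
      then have "(a, \<gamma>) \<in> ?K" using ky by (metis DiffD1 in_keys_iff)
      then have "(a, \<gamma>) \<in> Phi" "\<gamma> \<le> a"
        using Suc(3) assms(2) min unfolding supported_def by blast+
      then show False by (simp add: Phi_def)
    qed
    then have "Poly_Mapping.lookup (jmult y (root_elt (\<gamma>, \<delta>) (Poly_Mapping.lookup x (\<gamma>, \<delta>)))) (a, e) =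
       (\<Sum>b\<in>{}. Poly_Mapping.lookup y (a, b) * Poly_Mapping.lookup (root_elt (\<gamma>, \<delta>) (Poly_Mapping.lookup x (\<gamma>, \<delta>))) (b, e))"
      by (intro lookup_jmult) (auto simp: root_elt_def lookup_single when_def split: if_splits)
    then show "Poly_Mapping.lookup (jmult y (root_elt (\<gamma>, \<delta>) (Poly_Mapping.lookup x (\<gamma>, \<delta>)))) k =
        Poly_Mapping.lookup 0 k" by (simp add: k)
  qed
  then have "x = y \<star> root_elt (\<gamma>, \<delta>) (Poly_Mapping.lookup x (\<gamma>, \<delta>))"
    by (intro poly_mapping_eqI)
      (auto simp: McLain_simps lookup_add y_def lookup_restr root_elt_def lookup_single when_def)
  moreover have "P y"
  proof (rule Suc(1)[OF _ ys])
    show "n = card (Poly_Mapping.keys y)"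
      unfolding ky card_Diff_singleton[OF c] using Suc(2) by simp
  qed
  moreover have "(\<gamma>, \<delta>) \<in> \<Delta>" using Suc(3) c by (auto simp: supported_def)
  ultimately show ?case using assms(4)[of y "(\<gamma>, \<delta>)"] ys by metis
qed

lemma root_elt_supported [intro]: "c \<in> \<Delta> \<Longrightarrow> root_elt c r \<in> supported \<Delta>"
  by (auto simp: root_elt_def supported_iff lookup_single when_def)

text \<open>The two indices of a root differ, so its basis element has square zero.\<close>

lemma root_elt_mult_neg: 
  assumes "c \<in> Phi" shows "root_elt c r \<star> root_elt c (- r) = 0"
proof -
  have "jmult (root_elt c r) (root_elt c (- r)) = 0"
    using assms by (auto simp: jmult_def root_elt_def Phi_def)
  then show ?thesis by (simp add: McLain_simps root_elt_def flip: single_add)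
qed

text \<open>The inverse is assembled factor by factor along \<open>McLain_induct\<close>, which
  keeps it inside \<open>supported \<Delta>\<close>. Only the monoid laws are used, since the group
  property is deduced from the case of \<Delta> = \<open>Phi\<close>.\<close>

lemma supported_inverse:
  assumes "closed_roots \<Delta>" "\<Delta> \<subseteq> Phi" "x \<in> supported \<Delta>"
  shows "\<exists>z\<in>supported \<Delta>. z \<star> x = 0 \<and> x \<star> z = 0"
  using assms(3,2)
proof (induction rule: McLain_induct)
  case zero
  show ?case by (rule bexI[of _ 0]) (auto simp: McLain_simps supported_iff)
next
  case (mult y c r)
  interpret monoid McLain by (rule monoid_McLain)
  note cl = mmult_closed[OF assms(1)]
  have sub: "supported \<Delta> \<subseteq> carrier McLain" using assms(2) by (simp add: McLain_simps supported_mono)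
  obtain z where z: "z \<in> supported \<Delta>" "z \<star> y = 0" "y \<star> z = 0" using mult by auto
  have c: "root_elt c s \<in> supported \<Delta>" for s :: 'b using mult by auto
  have inv: "root_elt c r \<star> root_elt c (- r) = 0" "root_elt c (- r) \<star> root_elt c r = 0"
    using root_elt_mult_neg[of c r] root_elt_mult_neg[of c "- r"] mult assms(2) by auto
  have one: "0 \<star> u = u" "u \<star> 0 = u" for u :: "'a \<times> 'a \<Rightarrow>\<^sub>0 'b" by (simp_all add: McLain_simps)
  have car: "y \<in> carrier McLain" "z \<in> carrier McLain" "root_elt c s \<in> carrier McLain" for s :: 'b
    using z(1) mult(1) c sub by blast+
  have "(y \<star> root_elt c r) \<star> (root_elt c (- r) \<star> z) = y \<star> ((root_elt c r \<star> root_elt c (- r)) \<star> z)"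
    by (simp only: m_assoc car m_closed)
  moreover have "(root_elt c (- r) \<star> z) \<star> (y \<star> root_elt c r) = root_elt c (- r) \<star> ((z \<star> y) \<star> root_elt c r)"
    by (simp only: m_assoc car m_closed)
  ultimately show ?case
    using z c cl inv one by (intro bexI[of _ "root_elt c (- r) \<star> z"]) auto
qed

lemma group_McLain: "group (McLain :: ('l::linorder \<times> 'l \<Rightarrow>\<^sub>0 'r::ring_1) monoid)"
proof (rule monoid.group_l_invI[OF monoid_McLain])
  fix x :: "'l \<times> 'l \<Rightarrow>\<^sub>0 'r" assume "x \<in> carrier McLain"
  then show "\<exists>y\<in>carrier McLain. y \<star> x = \<one>\<^bsub>McLain\<^esub>"
    using supported_inverse[OF closed_Phi order_refl, of x] unfolding McLain_simps(1,2) by blast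
qed

lemma subgroup_supported:
  assumes "closed_roots \<Delta>" "\<Delta> \<subseteq> Phi"
  shows "subgroup (supported \<Delta>) (McLain :: ('l::linorder \<times> 'l \<Rightarrow>\<^sub>0 'r::ring_1) monoid)"
proof -
  interpret group "McLain :: ('l::linorder \<times> 'l \<Rightarrow>\<^sub>0 'r::ring_1) monoid" by (rule group_McLain)
  show ?thesis
  proof (rule subgroupI)
    show "supported \<Delta> \<subseteq> carrier McLain" using assms by (simp add: McLain_simps supported_mono)
    show "supported \<Delta> \<noteq> {}" by (auto simp: supported_def intro: exI[of _ 0])
    show "inv\<^bsub>McLain\<^esub> x \<in> supported \<Delta>" if "x \<in> supported \<Delta>" for x :: "'l \<times> 'l \<Rightarrow>\<^sub>0 'r"
    proof -
      obtain z where z: "z \<in> supported \<Delta>" "z \<star> x = 0" using supported_inverse[OF assms] \<open>x \<in> supported \<Delta>\<close> by blast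
      then have "minv x = z"
        using \<open>x \<in> supported \<Delta>\<close> supported_mono[OF assms(2)] by (intro inv_equality) (auto simp: McLain_simps(1,2))
      then show ?thesis using z by simp
    qed
    show "x \<star> y \<in> supported \<Delta>" if "x \<in> supported \<Delta>" "y \<in> supported \<Delta>" for x y :: "'l \<times> 'l \<Rightarrow>\<^sub>0 'r"
      using mmult_closed[OF assms(1) that] .
  qed
qed

text \<open>Membership in a generated subgroup becomes a condition on coordinates: closedness makes
  the coordinate set a subgroup, and the induction writes each of its elements as a product of root
  elements.\<close>

lemma M_of_eq_supported:
  assumes "closed_roots \<Delta>" "\<Delta> \<subseteq> Phi"
  shows "M_of \<Delta> = (supported \<Delta> :: ('l::linorder \<times> 'l \<Rightarrow>\<^sub>0 'r::ring_1) set)"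
proof
  interpret group "McLain :: ('l::linorder \<times> 'l \<Rightarrow>\<^sub>0 'r::ring_1) monoid" by (rule group_McLain)
  show "M_of \<Delta> \<subseteq> (supported \<Delta> :: ('l \<times> 'l \<Rightarrow>\<^sub>0 'r) set)"
    unfolding M_of_def
    by (rule generate_subgroup_incl[OF _ subgroup_supported[OF assms]]) (auto simp: root_subgroup_def)
  show "(supported \<Delta> :: ('l \<times> 'l \<Rightarrow>\<^sub>0 'r) set) \<subseteq> M_of \<Delta>"
  proof
    fix x :: "'l \<times> 'l \<Rightarrow>\<^sub>0 'r" assume "x \<in> supported \<Delta>"
    then show "x \<in> M_of \<Delta>" using assms(2)
    proof (induction rule: McLain_induct)
      case zero
      show ?case using generate.one[of McLain] by (simp add: M_of_def McLain_simps)
    next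
      case (mult y c r)
      have "root_elt c r \<in> M_of \<Delta>" unfolding M_of_def
        using mult by (intro generate.incl) (auto simp: root_subgroup_def)
      then show ?case using mult(3) unfolding M_of_def by (rule generate.eng[rotated])
    qed
  qed
qed

subsection \<open>Truncated rows and characters\<close>

text \<open>On M this is the relation of lying in the same right coset of H_i, where d =
  (\<alpha>_i, \<beta>_i). The bound is strict: the entry at \<open>d\<close> itself does not affect
  the coset, it feeds the character.\<close>

definition agree :: "'l::linorder \<times> 'l \<Rightarrow> ('l \<times> 'l \<Rightarrow>\<^sub>0 'r::ring_1) \<Rightarrow> ('l \<times> 'l \<Rightarrow>\<^sub>0 'r) \<Rightarrow> bool" where
  "agree d x y \<longleftrightarrow> (\<forall>c<snd d. Poly_Mapping.lookup x (fst d, c) = Poly_Mapping.lookup y (fst d, c))"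

lemma agree_refl [simp]: "agree d x x"
  by (simp add: agree_def)

lemma agree_sym: "agree d x y \<Longrightarrow> agree d y x"
  by (simp add: agree_def)

lemma agree_trans: "agree d x y \<Longrightarrow> agree d y z \<Longrightarrow> agree d x z"
  by (simp add: agree_def)

text \<open>As \<open>z\<close> is strictly triangular, the columns of \<open>x z\<close> up to \<open>snd d\<close> involve only the
  columns of \<open>x\<close> strictly to the left of \<open>snd d\<close>.\<close>

lemma lookup_mmult_diff:
  fixes x y z :: "'l::linorder \<times> 'l \<Rightarrow>\<^sub>0 'r::ring_1"
  assumes "agree d x y" "z \<in> supported Phi" "c \<le> snd d"
  shows "Poly_Mapping.lookup (x \<star> z) (fst d, c) - Poly_Mapping.lookup (y \<star> z) (fst d, c) =
    Poly_Mapping.lookup x (fst d, c) - Poly_Mapping.lookup y (fst d, c)"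
proof -
  \<comment> \<open>One range for both products; b < c \<le> \<open>snd d\<close> keeps every index
    in the columns where x and y agree.\<close>
  let ?S = "{b \<in> snd ` Poly_Mapping.keys x \<union> snd ` Poly_Mapping.keys y. b < c}"
  have lt: "b < c" if "Poly_Mapping.lookup z (b, c) \<noteq> 0" for b
    using supportedD[OF assms(2), of "(b, c)"] that by (auto simp: Phi_def)
  have 1: "Poly_Mapping.lookup (w \<star> z) (fst d, c) =
      Poly_Mapping.lookup w (fst d, c) + Poly_Mapping.lookup z (fst d, c) +
      (\<Sum>b\<in>?S. Poly_Mapping.lookup w (fst d, b) * Poly_Mapping.lookup z (b, c))"
    if "w = x \<or> w = y" for w
    using that by (intro lookup_mmult) (auto intro: lookup_keys_image(2) lt)
  have "(\<Sum>b\<in>?S. Poly_Mapping.lookup x (fst d, b) * Poly_Mapping.lookup z (b, c)) =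
        (\<Sum>b\<in>?S. Poly_Mapping.lookup y (fst d, b) * Poly_Mapping.lookup z (b, c))"
    using assms by (intro sum.cong) (auto simp: agree_def)
  then show ?thesis by (simp add: 1)
qed

lemma agree_mmult:
  assumes "agree d x y" "z \<in> supported Phi"
  shows "agree d (x \<star> z) (y \<star> z)"
  unfolding agree_def
proof (intro allI impI)
  fix c assume "c < snd d"
  then show "Poly_Mapping.lookup (x \<star> z) (fst d, c) = Poly_Mapping.lookup (y \<star> z) (fst d, c)"
    using lookup_mmult_diff[OF assms, of c] assms(1) by (simp add: agree_def)
qed

lemma zero_mmult [simp]: "0 \<star> z = z" "z \<star> 0 = z"
  by (simp_all add: McLain_simps)

lemma agree_zero_mmult: "agree d h 0 \<Longrightarrow> z \<in> supported Phi \<Longrightarrow> agree d (h \<star> z) z"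
  using agree_mmult[of d h 0 z] by simp

text \<open>Additivity of the entry at \<open>d\<close> on elements with vanishing truncated row is
  what turns a linear character of R into a homomorphism on H_i.\<close>

lemma lookup_mmult_agree:
  "agree d h 0 \<Longrightarrow> z \<in> supported Phi \<Longrightarrow>
    Poly_Mapping.lookup (h \<star> z) d = Poly_Mapping.lookup h d + Poly_Mapping.lookup z d"
  using lookup_mmult_diff[of d h 0 z "snd d"] by (simp add: algebra_simps)

lemma minv_supported: "x \<in> supported Phi \<Longrightarrow> minv x \<in> supported Phi"
  using group.inv_closed[OF group_McLain, of x] by (simp add: McLain_simps(1))

lemma mmult_supported: "x \<in> supported Phi \<Longrightarrow> y \<in> supported Phi \<Longrightarrow> x \<star> y \<in> supported Phi"
  using mmult_closed[OF closed_Phi] .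

lemma mmult_minv: "x \<in> supported Phi \<Longrightarrow> x \<star> minv x = 0" "x \<in> supported Phi \<Longrightarrow> minv x \<star> x = 0"
  using group.r_inv[OF group_McLain, of x] group.l_inv[OF group_McLain, of x]
  by (simp_all add: McLain_simps(1,2))

lemma mmult_assoc:
  "x \<in> supported Phi \<Longrightarrow> y \<in> supported Phi \<Longrightarrow> z \<in> supported Phi \<Longrightarrow> x \<star> y \<star> z = x \<star> (y \<star> z)"
  using monoid.m_assoc[OF monoid_McLain, of x y z] by (simp add: McLain_simps(1))

lemma agree_mmult_cancel:
  assumes "agree d (x \<star> z) (y \<star> z)" "x \<in> supported Phi" "y \<in> supported Phi" "z \<in> supported Phi"
  shows "agree d x y"
  using agree_mmult[OF assms(1) minv_supported[OF assms(4)]] assms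
  by (simp add: mmult_assoc minv_supported mmult_minv)

section \<open>Linear characters and the characters they induce on subgroups of M\<close>

lemma linear_character_add: "linear_character \<mu> \<Longrightarrow> \<mu> (x + y) = \<mu> x * \<mu> y"
  by (auto simp: linear_character_def hom_def ring_of_type_algebra_def)

lemma linear_character_nonzero: "linear_character \<mu> \<Longrightarrow> \<mu> x \<noteq> 0"
  by (auto simp: linear_character_def hom_def ring_of_type_algebra_def)

lemma linear_character_zero: "linear_character \<mu> \<Longrightarrow> \<mu> 0 = 1"
  using linear_character_add[of \<mu> 0 0] linear_character_nonzero[of \<mu> 0] by simp

text \<open>The character of the paper's \<open>H\<^sub>i\<close>, where \<open>d = (\<alpha>\<^sub>i, \<beta>\<^sub>i)\<close>, extended by \<open>0\<close>.\<close>

definition row_char :: "'l::linorder \<times> 'l \<Rightarrow> ('r::ring_1 \<Rightarrow> 'f::field) \<Rightarrow> ('l \<times> 'l \<Rightarrow>\<^sub>0 'r) \<Rightarrow> 'f" where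
  "row_char d \<mu> z = (if agree d z 0 then \<mu> (Poly_Mapping.lookup z d) else 0)"

lemma row_char_cong:
  "agree d x y \<Longrightarrow> Poly_Mapping.lookup x d = Poly_Mapping.lookup y d \<Longrightarrow> row_char d \<mu> x = row_char d \<mu> y"
  unfolding row_char_def by (metis agree_sym agree_trans)

text \<open>A left factor enters only through its truncated row and its entry at \<open>d\<close>.
  This allows it to be replaced by its component in L, or by its truncated row when the entry at
  \<open>d\<close> is zero.\<close>

lemma row_char_cong_mmult:
  assumes "agree d x y" "Poly_Mapping.lookup x d = Poly_Mapping.lookup y d" "z \<in> supported Phi"
  shows "row_char d \<mu> (x \<star> z) = row_char d \<mu> (y \<star> z)"
  using agree_mmult[OF assms(1,3)] lookup_mmult_diff[OF assms(1,3), of "snd d"] assms(2)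
  by (intro row_char_cong) auto

text \<open>Right multiplication by an element of H_i preserves both H_i and its complement in M, so
  the extension by zero remains multiplicative in this factor.\<close>

lemma row_char_mult:
  assumes "linear_character \<mu>" "agree d h 0" "h \<in> supported Phi" "z \<in> supported Phi"
  shows "row_char d \<mu> (z \<star> h) = row_char d \<mu> z * \<mu> (Poly_Mapping.lookup h d)"
proof (cases "agree d z 0")
  case True
  have "agree d (z \<star> h) 0" using agree_zero_mmult[OF True assms(3)] assms(2) agree_trans by blast
  then show ?thesis
    using True lookup_mmult_agree[OF True assms(3)]
    by (simp add: row_char_def linear_character_add[OF assms(1)])
next
  case False
  have "\<not> agree d (z \<star> h) 0"
  proof
    assume "agree d (z \<star> h) 0"
    \<comment> \<open>As \<open>h\<close> has zero truncated row, 0 may be replaced by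
      \<open>0 \<star> h\<close>, and the common right factor cancels.\<close>
    then have "agree d (z \<star> h) (0 \<star> h)" using assms(2) agree_sym agree_trans by (metis zero_mmult(1))
    then show False using agree_mmult_cancel[of d z h 0] False assms(3,4) by (auto simp: supported_def)
  qed
  then show ?thesis using False by (simp add: row_char_def)
qed

text \<open>Replaces the definite description by a formula. Existence is the additivity of the entry
  at \<open>d\<close> on elements with vanishing truncated row; uniqueness holds because the root
  elements generate. The candidate is restricted to \<open>M_of \<Delta>\<close> to meet the
  extensionality clause.\<close>

lemma root_character_eq:
  fixes \<mu> :: "'r::ring_1 \<Rightarrow> 'f::field" and d :: "'l::linorder \<times> 'l"
  assumes \<mu>: "linear_character \<mu>" and \<Delta>: "closed_roots \<Delta>" "\<Delta> \<subseteq> Phi" "d \<in> \<Delta>"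
    and row: "\<And>x. x \<in> supported \<Delta> \<Longrightarrow> agree d x (0 :: 'l \<times> 'l \<Rightarrow>\<^sub>0 'r)"
    and h: "h \<in> supported \<Delta>"
  shows "root_character \<Delta> d \<mu> h = \<mu> (Poly_Mapping.lookup h d)"
proof -
  let ?M = "M_of \<Delta> :: ('l \<times> 'l \<Rightarrow>\<^sub>0 'r) set"
  let ?G = "McLain\<lparr>carrier := ?M\<rparr>"
  define \<chi>0 where "\<chi>0 = restrict (\<lambda>x. \<mu> (Poly_Mapping.lookup x d)) ?M"
  note M = M_of_eq_supported[OF \<Delta>(1,2), where 'r='r]
  define P where "P \<chi> \<longleftrightarrow> \<chi> \<in> hom ?G (mult_of (Ring :: 'f ring)) \<and> \<chi> \<in> extensional ?M \<and>
     (\<forall>r. \<chi> (root_elt d r) = \<mu> r) \<and> (\<forall>c\<in>\<Delta> - {d}. \<forall>r. \<chi> (root_elt c r) = 1)" for \<chi>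
  have sub: "supported \<Delta> \<subseteq> supported Phi" by (rule supported_mono[OF \<Delta>(2)])
  have \<chi>0_mult: "\<chi>0 (x \<star> y) = \<chi>0 x * \<chi>0 y" if "x \<in> ?M" "y \<in> ?M" for x y
    using that mmult_closed[OF \<Delta>(1)] lookup_mmult_agree[OF row] sub
    by (auto simp: \<chi>0_def M linear_character_add[OF \<mu>])
  have nz: "\<chi>0 x \<noteq> 0" if "x \<in> ?M" for x
    using that by (simp add: \<chi>0_def linear_character_nonzero[OF \<mu>])
  have "P \<chi>0"
    unfolding P_def
  proof (intro conjI ballI allI)
    show "\<chi>0 \<in> hom ?G (mult_of (Ring :: 'f ring))"
      using \<chi>0_mult nz by (auto simp: hom_def ring_of_type_algebra_def)
    show "\<chi>0 \<in> extensional ?M" by (simp add: \<chi>0_def)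
    show "\<chi>0 (root_elt d r) = \<mu> r" for r
      using \<Delta>(3) by (simp add: \<chi>0_def M root_elt_supported) (simp add: root_elt_def)
    show "\<chi>0 (root_elt c r) = 1" if "c \<in> \<Delta> - {d}" for c r
      using that by (simp add: \<chi>0_def M root_elt_supported)
        (simp add: root_elt_def lookup_single linear_character_zero[OF \<mu>])
  qed
  moreover have "\<chi> = \<chi>0" if "P \<chi>" for \<chi>
  proof (rule extensionalityI)
    show "\<chi> \<in> extensional ?M" "\<chi>0 \<in> extensional ?M"
      using \<open>P \<chi>\<close> \<open>P \<chi>0\<close> by (auto simp: P_def)
    have \<chi>: "\<chi> (x \<star> y) = \<chi> x * \<chi> y" "\<chi> x \<noteq> 0" if "x \<in> supported \<Delta>" "y \<in> supported \<Delta>" for x y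
      using \<open>P \<chi>\<close> that by (auto simp: P_def hom_def ring_of_type_algebra_def M)
    have roots: "\<chi> (root_elt c r) = \<chi>0 (root_elt c r)" if "c \<in> \<Delta>" for c r
      using \<open>P \<chi>\<close> \<open>P \<chi>0\<close> that unfolding P_def by (cases "c = d") auto
    fix x assume "x \<in> ?M"
    then have "x \<in> supported \<Delta>" by (simp add: M)
    then show "\<chi> x = \<chi>0 x" using \<Delta>(2)
    proof (induction rule: McLain_induct)
      case zero
      have "(0 :: 'l \<times> 'l \<Rightarrow>\<^sub>0 'r) \<in> supported \<Delta>" by (simp add: supported_def)
      then show ?case using \<chi>(1)[of 0 0] \<chi>(2)[of 0 0] linear_character_zero[OF \<mu>] by (simp add: \<chi>0_def M)
    next
      case (mult y c r)
      then show ?case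
        using \<chi>(1)[of y "root_elt c r"] \<chi>0_mult[of y "root_elt c r"] roots[of c r]
        by (simp add: M root_elt_supported)
    qed
  qed
  ultimately have "root_character \<Delta> d \<mu> = \<chi>0"
    unfolding root_character_def P_def[symmetric] by (rule the_equality)
  then show ?thesis using h by (simp add: \<chi>0_def M)
qed

subsection \<open>Realizations of modules by functions\<close>

text \<open>\<open>\<theta>\<close> embeds the module \<open>V\<close> into the functions on a set \<open>\<Omega>\<close> of points with right action
  \<open>\<tau>\<close> of the group, where \<open>(g \<phi>)(x) = \<phi> (x g)\<close>. The points in \<open>R \<subseteq> \<Omega>\<close> index a basis \<open>e\<close> of \<open>V\<close>
  dual to the evaluations at these points.\<close>

locale realization = group G for G :: "('g, 'k) monoid_scheme" (structure) +
  fixes V :: "('g, 'f::field, 'v) gspace" and \<Omega> :: "'x set" and \<tau> :: "'g \<Rightarrow> 'x \<Rightarrow> 'x"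
    and \<theta> :: "'v \<Rightarrow> 'x \<Rightarrow> 'f" and R :: "'x set" and e :: "'x \<Rightarrow> 'v"
  assumes zero_closed: "\<zero>\<^bsub>V\<^esub> \<in> carrier V"
    and add_closed: "v \<in> carrier V \<Longrightarrow> w \<in> carrier V \<Longrightarrow> v \<oplus>\<^bsub>V\<^esub> w \<in> carrier V"
    and smult_closed: "v \<in> carrier V \<Longrightarrow> c \<odot>\<^bsub>V\<^esub> v \<in> carrier V"
    and act_closed: "g \<in> carrier G \<Longrightarrow> v \<in> carrier V \<Longrightarrow> act V g v \<in> carrier V"
    and \<tau>_closed: "g \<in> carrier G \<Longrightarrow> x \<in> \<Omega> \<Longrightarrow> \<tau> g x \<in> \<Omega>"
    and \<tau>_one: "x \<in> \<Omega> \<Longrightarrow> \<tau> \<one> x = x"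
    and \<tau>_mult: "g \<in> carrier G \<Longrightarrow> h \<in> carrier G \<Longrightarrow> x \<in> \<Omega> \<Longrightarrow> \<tau> (g \<otimes> h) x = \<tau> h (\<tau> g x)"
    and \<theta>_zero: "x \<in> \<Omega> \<Longrightarrow> \<theta> \<zero>\<^bsub>V\<^esub> x = 0"
    and \<theta>_add: "v \<in> carrier V \<Longrightarrow> w \<in> carrier V \<Longrightarrow> x \<in> \<Omega> \<Longrightarrow> \<theta> (v \<oplus>\<^bsub>V\<^esub> w) x = \<theta> v x + \<theta> w x"
    and \<theta>_smult: "v \<in> carrier V \<Longrightarrow> x \<in> \<Omega> \<Longrightarrow> \<theta> (c \<odot>\<^bsub>V\<^esub> v) x = c * \<theta> v x"
    and \<theta>_act: "g \<in> carrier G \<Longrightarrow> v \<in> carrier V \<Longrightarrow> x \<in> \<Omega> \<Longrightarrow> \<theta> (act V g v) x = \<theta> v (\<tau> g x)"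
    and \<theta>_inj: "v \<in> carrier V \<Longrightarrow> w \<in> carrier V \<Longrightarrow> (\<And>x. x \<in> \<Omega> \<Longrightarrow> \<theta> v x = \<theta> w x) \<Longrightarrow> v = w"
    and R_subset: "R \<subseteq> \<Omega>"
    and e_closed: "y \<in> R \<Longrightarrow> e y \<in> carrier V"
    and e_dual: "y \<in> R \<Longrightarrow> y' \<in> R \<Longrightarrow> \<theta> (e y) y' = (if y = y' then 1 else 0)"
    \<comment> \<open>Spanning is stated as an induction principle, so that no linear combinations
      have to be formed with the abstract operations of \<open>V\<close>.\<close>
    and e_span: "v \<in> carrier V \<Longrightarrow> P \<zero>\<^bsub>V\<^esub> \<Longrightarrow> (\<And>y. y \<in> R \<Longrightarrow> P (e y)) \<Longrightarrow>
      (\<And>v w. v \<in> carrier V \<Longrightarrow> w \<in> carrier V \<Longrightarrow> P v \<Longrightarrow> P w \<Longrightarrow> P (v \<oplus>\<^bsub>V\<^esub> w)) \<Longrightarrow>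
      (\<And>c v. v \<in> carrier V \<Longrightarrow> P v \<Longrightarrow> P (c \<odot>\<^bsub>V\<^esub> v)) \<Longrightarrow> P v"
begin

text \<open>Since \<theta> separates vectors, each module axiom reduces to the same identity between
  field-valued functions; the multiple by -1 serves as additive inverse.\<close>

lemma gmodule: "gmodule G V"
proof -
  note closed = zero_closed add_closed smult_closed act_closed
  note eqs = \<theta>_zero \<theta>_add \<theta>_smult \<theta>_act \<tau>_closed \<tau>_one \<tau>_mult
  have "abelian_group V"
  proof (rule abelian_groupI)
    fix v assume "v \<in> carrier V"
    then show "\<exists>w\<in>carrier V. w \<oplus>\<^bsub>V\<^esub> v = \<zero>\<^bsub>V\<^esub>"
      by (intro bexI[of _ "(- 1) \<odot>\<^bsub>V\<^esub> v"] \<theta>_inj) (simp_all add: closed eqs)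
  qed (auto intro!: \<theta>_inj closed simp: closed eqs)
  moreover have "cring (Ring :: 'f ring)"
    by (rule cring_from_type_algebra)
  ultimately have "Module.module (Ring :: 'f ring) V"
    by (intro moduleI)
      (auto intro!: \<theta>_inj simp: closed eqs ring_of_type_algebra_def algebra_simps)
  then show ?thesis
    by (intro gmodule.intro gmodule_axioms.intro group_axioms \<theta>_inj)
      (auto simp: closed eqs)
qed

end

text \<open>Both modules are identified with the span of the same functions.\<close>

lemma realizations_iso:
  assumes "realization G V \<Omega> \<tau> \<theta> R e" "realization G W \<Omega> \<tau> \<theta>' R e'"
    and eq: "\<And>x y. x \<in> \<Omega> \<Longrightarrow> y \<in> R \<Longrightarrow> \<theta> (e y) x = \<theta>' (e' y) x"
  shows "gmodule_iso G V W"
proof -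
  interpret V: realization G V \<Omega> \<tau> \<theta> R e by fact
  interpret W: realization G W \<Omega> \<tau> \<theta>' R e' by fact
  \<comment> \<open>Having a counterpart with the same function is inherited by zero, sums and
    multiples, so agreement of the basis functions suffices.\<close>
  have ex1: "\<exists>w\<in>carrier W. \<forall>x\<in>\<Omega>. \<theta> v x = \<theta>' w x" if "v \<in> carrier V" for v
    using that
  proof (rule V.e_span)
    show "\<exists>w\<in>carrier W. \<forall>x\<in>\<Omega>. \<theta> \<zero>\<^bsub>V\<^esub> x = \<theta>' w x"
      using W.zero_closed V.\<theta>_zero W.\<theta>_zero by auto
    show "\<exists>w\<in>carrier W. \<forall>x\<in>\<Omega>. \<theta> (e y) x = \<theta>' w x" if "y \<in> R" for y
      using that W.e_closed eq by auto
    show "\<exists>w\<in>carrier W. \<forall>x\<in>\<Omega>. \<theta> (v \<oplus>\<^bsub>V\<^esub> v') x = \<theta>' w x"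
      if v: "v \<in> carrier V" "v' \<in> carrier V" and "\<exists>w\<in>carrier W. \<forall>x\<in>\<Omega>. \<theta> v x = \<theta>' w x"
        "\<exists>w\<in>carrier W. \<forall>x\<in>\<Omega>. \<theta> v' x = \<theta>' w x" for v v'
    proof -
      obtain w w' where "w \<in> carrier W" "w' \<in> carrier W" "\<forall>x\<in>\<Omega>. \<theta> v x = \<theta>' w x" "\<forall>x\<in>\<Omega>. \<theta> v' x = \<theta>' w' x"
        using \<open>\<exists>w\<in>carrier W. \<forall>x\<in>\<Omega>. \<theta> v x = \<theta>' w x\<close> \<open>\<exists>w\<in>carrier W. \<forall>x\<in>\<Omega>. \<theta> v' x = \<theta>' w x\<close> by blast
      then show ?thesis
        using v by (intro bexI[of _ "w \<oplus>\<^bsub>W\<^esub> w'"]) (auto simp: V.\<theta>_add W.\<theta>_add W.add_closed)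
    qed
    show "\<exists>w\<in>carrier W. \<forall>x\<in>\<Omega>. \<theta> (c \<odot>\<^bsub>V\<^esub> v) x = \<theta>' w x"
      if v: "v \<in> carrier V" and "\<exists>w\<in>carrier W. \<forall>x\<in>\<Omega>. \<theta> v x = \<theta>' w x" for c v
    proof -
      obtain w where "w \<in> carrier W" "\<forall>x\<in>\<Omega>. \<theta> v x = \<theta>' w x"
        using \<open>\<exists>w\<in>carrier W. \<forall>x\<in>\<Omega>. \<theta> v x = \<theta>' w x\<close> by blast
      then show ?thesis
        using v by (intro bexI[of _ "c \<odot>\<^bsub>W\<^esub> w"]) (auto simp: V.\<theta>_smult W.\<theta>_smult W.smult_closed)
    qed
  qed
  have ex2: "\<exists>v\<in>carrier V. \<forall>x\<in>\<Omega>. \<theta> v x = \<theta>' w x" if "w \<in> carrier W" for w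
    using that
  proof (rule W.e_span)
    show "\<exists>v\<in>carrier V. \<forall>x\<in>\<Omega>. \<theta> v x = \<theta>' \<zero>\<^bsub>W\<^esub> x"
      using V.zero_closed V.\<theta>_zero W.\<theta>_zero by auto
    show "\<exists>v\<in>carrier V. \<forall>x\<in>\<Omega>. \<theta> v x = \<theta>' (e' y) x" if "y \<in> R" for y
      using that V.e_closed eq by auto
    show "\<exists>v\<in>carrier V. \<forall>x\<in>\<Omega>. \<theta> v x = \<theta>' (w \<oplus>\<^bsub>W\<^esub> w') x"
      if v: "w \<in> carrier W" "w' \<in> carrier W" and "\<exists>v\<in>carrier V. \<forall>x\<in>\<Omega>. \<theta> v x = \<theta>' w x"
        "\<exists>v\<in>carrier V. \<forall>x\<in>\<Omega>. \<theta> v x = \<theta>' w' x" for w w'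
    proof -
      obtain v v' where "v \<in> carrier V" "v' \<in> carrier V" "\<forall>x\<in>\<Omega>. \<theta> v x = \<theta>' w x" "\<forall>x\<in>\<Omega>. \<theta> v' x = \<theta>' w' x"
        using \<open>\<exists>v\<in>carrier V. \<forall>x\<in>\<Omega>. \<theta> v x = \<theta>' w x\<close> \<open>\<exists>v\<in>carrier V. \<forall>x\<in>\<Omega>. \<theta> v x = \<theta>' w' x\<close> by blast
      then show ?thesis
        using v by (intro bexI[of _ "v \<oplus>\<^bsub>V\<^esub> v'"]) (auto simp: V.\<theta>_add W.\<theta>_add V.add_closed)
    qed
    show "\<exists>v\<in>carrier V. \<forall>x\<in>\<Omega>. \<theta> v x = \<theta>' (c \<odot>\<^bsub>W\<^esub> w) x"
      if v: "w \<in> carrier W" and "\<exists>v\<in>carrier V. \<forall>x\<in>\<Omega>. \<theta> v x = \<theta>' w x" for c w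
    proof -
      obtain v where "v \<in> carrier V" "\<forall>x\<in>\<Omega>. \<theta> v x = \<theta>' w x"
        using \<open>\<exists>v\<in>carrier V. \<forall>x\<in>\<Omega>. \<theta> v x = \<theta>' w x\<close> by blast
      then show ?thesis
        using v by (intro bexI[of _ "c \<odot>\<^bsub>V\<^esub> v"]) (auto simp: V.\<theta>_smult W.\<theta>_smult V.smult_closed)
    qed
  qed
  \<comment> \<open>Counterparts are unique because functions separate vectors, so linearity and
    equivariance of any choice can be tested pointwise.\<close>
  obtain \<phi> where \<phi>: "\<And>v. v \<in> carrier V \<Longrightarrow> \<phi> v \<in> carrier W"
    "\<And>v x. v \<in> carrier V \<Longrightarrow> x \<in> \<Omega> \<Longrightarrow> \<theta>' (\<phi> v) x = \<theta> v x"
    using ex1 by metis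
  have "bij_betw \<phi> (carrier V) (carrier W)"
    unfolding bij_betw_def
  proof (intro conjI inj_onI equalityI subsetI)
    fix v v' assume "v \<in> carrier V" "v' \<in> carrier V" "\<phi> v = \<phi> v'"
    then show "v = v'" using \<phi>(2) by (intro V.\<theta>_inj) metis+
  next
    fix w assume w: "w \<in> carrier W"
    then obtain v where "v \<in> carrier V" "\<forall>x\<in>\<Omega>. \<theta> v x = \<theta>' w x" using ex2 by blast
    then have "w = \<phi> v" using \<phi> w by (intro W.\<theta>_inj) auto
    then show "w \<in> \<phi> ` carrier V" using \<open>v \<in> carrier V\<close> by blast
  qed (use \<phi> in auto)
  moreover have "\<forall>v\<in>carrier V. \<forall>v'\<in>carrier V. \<phi> (v \<oplus>\<^bsub>V\<^esub> v') = \<phi> v \<oplus>\<^bsub>W\<^esub> \<phi> v'"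
    by (auto intro!: W.\<theta>_inj simp: \<phi> V.add_closed W.add_closed V.\<theta>_add W.\<theta>_add)
  moreover have "\<forall>c. \<forall>v\<in>carrier V. \<phi> (c \<odot>\<^bsub>V\<^esub> v) = c \<odot>\<^bsub>W\<^esub> \<phi> v"
    by (auto intro!: W.\<theta>_inj simp: \<phi> V.smult_closed W.smult_closed V.\<theta>_smult W.\<theta>_smult)
  moreover have "\<forall>g\<in>carrier G. \<forall>v\<in>carrier V. \<phi> (act V g v) = act W g (\<phi> v)"
    by (auto intro!: W.\<theta>_inj simp: \<phi> V.act_closed W.act_closed V.\<theta>_act W.\<theta>_act V.\<tau>_closed)
  ultimately show ?thesis
    unfolding gmodule_iso_def using V.gmodule W.gmodule by blast
qed

subsection \<open>Linear functionals on free spaces\<close>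

definition lin_fun :: "('x \<Rightarrow> 'f) \<Rightarrow> ('x \<Rightarrow>\<^sub>0 'f::field) \<Rightarrow> 'f" where
  "lin_fun \<phi> p = (\<Sum>x\<in>Poly_Mapping.keys p. Poly_Mapping.lookup p x * \<phi> x)"

text \<open>Cancellation can make the keys of a sum or a multiple smaller than expected; a larger
  common range of summation avoids tracking it.\<close>

lemma lin_fun_superset:
  "finite A \<Longrightarrow> Poly_Mapping.keys p \<subseteq> A \<Longrightarrow> lin_fun \<phi> p = (\<Sum>x\<in>A. Poly_Mapping.lookup p x * \<phi> x)"
  unfolding lin_fun_def by (rule sum.mono_neutral_left) (auto simp: in_keys_iff)

lemma lin_fun_zero [simp]: "lin_fun \<phi> 0 = 0"
  by (simp add: lin_fun_def)

lemma lin_fun_add: "lin_fun \<phi> (p + q) = lin_fun \<phi> p + lin_fun \<phi> q"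
  using keys_add[of p q]
  by (simp add: lin_fun_superset[of "Poly_Mapping.keys p \<union> Poly_Mapping.keys q"] lookup_add
      distrib_right sum.distrib)

lemma keys_scale: "Poly_Mapping.keys (scale c p) \<subseteq> Poly_Mapping.keys p"
  by (auto simp: in_keys_iff lookup_scale)

lemma lin_fun_scale: "lin_fun \<phi> (scale c p) = c * lin_fun \<phi> p"
  by (simp add: lin_fun_superset[OF finite_keys keys_scale] lookup_scale)
    (simp add: lin_fun_def sum_distrib_left mult.assoc)

lemma lin_fun_diff: "lin_fun \<phi> (p - q) = lin_fun \<phi> p - lin_fun \<phi> q"
  using lin_fun_add[of \<phi> "p - q" q] by simp

lemma lin_fun_sum: "lin_fun \<phi> (sum f A) = (\<Sum>a\<in>A. lin_fun \<phi> (f a))"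
  by (induction A rule: infinite_finite_induct) (auto simp: lin_fun_add)

lemma lin_fun_single: "lin_fun \<phi> (Poly_Mapping.single x c) = c * \<phi> x"
  by (simp add: lin_fun_superset[of "{x}"])

lemma lin_fun_basis_elt [simp]: "lin_fun \<phi> (basis_elt x) = \<phi> x"
  by (simp add: basis_elt_def lin_fun_single)

lemma keys_basis_elt [simp]: "Poly_Mapping.keys (basis_elt x :: 'x \<Rightarrow>\<^sub>0 'f::field) = {x}"
  by (simp add: basis_elt_def)

lemma scale_basis_elt: "scale c (basis_elt x) = Poly_Mapping.single x c"
  by (rule poly_mapping_eqI) (simp add: lookup_scale basis_elt_def lookup_single when_def)

lemma sum_basis_elt: "p = (\<Sum>x\<in>Poly_Mapping.keys p. scale (Poly_Mapping.lookup p x) (basis_elt x))"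
  by (rule poly_mapping_eqI)
    (simp add: scale_basis_elt lookup_sum lookup_single when_def sum.delta' in_keys_iff)

text \<open>Evaluating after an action on generators is evaluating a pulled-back functional. In this
  way an action on generators becomes a motion of the points.\<close>

lemma lin_fun_lin_ext: "lin_fun \<phi> (lin_ext b p) = lin_fun (\<phi> \<circ> b) p"
  by (simp add: lin_ext_def lin_fun_sum lin_fun_scale) (simp add: lin_fun_def)

lemma keys_lin_ext:
  assumes "Poly_Mapping.keys p \<subseteq> B" "\<And>x. x \<in> B \<Longrightarrow> b x \<in> B"
  shows "Poly_Mapping.keys (lin_ext b p) \<subseteq> B"
proof -
  have "Poly_Mapping.keys (lin_ext b p) \<subseteq>
      (\<Union>x\<in>Poly_Mapping.keys p. Poly_Mapping.keys (scale (Poly_Mapping.lookup p x) (basis_elt (b x))))"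
    unfolding lin_ext_def by (rule keys_sum)
  also have "\<dots> \<subseteq> B"
  proof (rule UN_least)
    fix x assume "x \<in> Poly_Mapping.keys p"
    then have "b x \<in> B" using assms by blast
    then show "Poly_Mapping.keys (scale (Poly_Mapping.lookup p x) (basis_elt (b x))) \<subseteq> B"
      using keys_scale[of "Poly_Mapping.lookup p x" "basis_elt (b x)"] by auto
  qed
  finally show ?thesis .
qed

lemma subspace_keys: "free.subspace {p. Poly_Mapping.keys p \<subseteq> B}"
proof (rule free.subspaceI)
  show "p + q \<in> {p. Poly_Mapping.keys p \<subseteq> B}"
    if "p \<in> {p. Poly_Mapping.keys p \<subseteq> B}" "q \<in> {p. Poly_Mapping.keys p \<subseteq> B}" for p q
    using that keys_add[of p q] by blast
  show "scale c p \<in> {p. Poly_Mapping.keys p \<subseteq> B}"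
    if "p \<in> {p. Poly_Mapping.keys p \<subseteq> B}" for c p
    using that keys_scale[of c p] by blast
qed simp

lemma subspace_lin_fun: "free.subspace {p. lin_fun \<phi> p = 0}"
  by (rule free.subspaceI) (simp_all add: lin_fun_add lin_fun_scale)

subsection \<open>Realizing the module constructions\<close>

lemma keys_diff_subset:
  fixes p q :: "'x \<Rightarrow>\<^sub>0 'f::field"
  shows "Poly_Mapping.keys p \<subseteq> B \<Longrightarrow> Poly_Mapping.keys q \<subseteq> B \<Longrightarrow> Poly_Mapping.keys (p - q) \<subseteq> B"
  using free.subspace_diff[OF subspace_keys, of p B q] by simp

lemma keys_scale_subset: "Poly_Mapping.keys p \<subseteq> B \<Longrightarrow> Poly_Mapping.keys (scale c p) \<subseteq> B"
  by (rule subset_trans[OF keys_scale])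

lemma keys_basis_subset: "x \<in> B \<Longrightarrow> Poly_Mapping.keys (basis_elt x :: 'x \<Rightarrow>\<^sub>0 'f::field) \<subseteq> B"
  by simp

text \<open>\<open>\<psi> x y\<close> is the value of the generator x at the point y. By
  \<open>kill\<close>, evaluation descends to cosets. By \<open>span\<close> and
  \<open>dual\<close>, a vector vanishing at all points of \<open>R\<close> lies in the span of
  \<open>T\<close>: modulo \<open>T\<close> it is a combination of the generators
  \<open>e y\<close>, and evaluation at y reads off the coefficient. So the span of \<open>T\<close>
  is exactly a common kernel, and its invariance under the action is a consequence, not an
  assumption.\<close>

lemma free_quotient_realization:
  fixes B :: "'x set" and T :: "('x \<Rightarrow>\<^sub>0 'f::field) set" and \<psi> :: "'x \<Rightarrow> 'y \<Rightarrow> 'f" and e :: "'y \<Rightarrow> 'x"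
  assumes G: "group G"
    and \<tau>_closed: "\<And>g x. g \<in> carrier G \<Longrightarrow> x \<in> \<Omega> \<Longrightarrow> \<tau> g x \<in> \<Omega>"
    and \<tau>_one: "\<And>x. x \<in> \<Omega> \<Longrightarrow> \<tau> \<one>\<^bsub>G\<^esub> x = x"
    and \<tau>_mult: "\<And>g h x. g \<in> carrier G \<Longrightarrow> h \<in> carrier G \<Longrightarrow> x \<in> \<Omega> \<Longrightarrow> \<tau> (g \<otimes>\<^bsub>G\<^esub> h) x = \<tau> h (\<tau> g x)"
    and T: "\<And>t. t \<in> T \<Longrightarrow> Poly_Mapping.keys t \<subseteq> B"
    and kill: "\<And>t y. t \<in> T \<Longrightarrow> y \<in> \<Omega> \<Longrightarrow> lin_fun (\<lambda>x. \<psi> x y) t = 0"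
    and b: "\<And>g x. g \<in> carrier G \<Longrightarrow> x \<in> B \<Longrightarrow> b g x \<in> B"
    and \<psi>_b: "\<And>g x y. g \<in> carrier G \<Longrightarrow> x \<in> B \<Longrightarrow> y \<in> \<Omega> \<Longrightarrow> \<psi> (b g x) y = \<psi> x (\<tau> g y)"
    and R: "R \<subseteq> \<Omega>"
    and e: "\<And>y. y \<in> R \<Longrightarrow> e y \<in> B"
    and dual: "\<And>y y'. y \<in> R \<Longrightarrow> y' \<in> R \<Longrightarrow> \<psi> (e y) y' = (if y = y' then 1 else 0)"
    and span: "\<And>x. x \<in> B \<Longrightarrow> basis_elt x \<in> free.span (T \<union> basis_elt ` e ` R)"
  shows "\<exists>\<theta> e'. realization G (free_quotient B T b) \<Omega> \<tau> \<theta> R e' \<and>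
    (\<forall>y\<in>R. \<forall>x\<in>\<Omega>. \<theta> (e' y) x = \<psi> (e y) x)"
proof -
  let ?V = "free_quotient B T b"
  define K :: "('x \<Rightarrow>\<^sub>0 'f) set" where "K = {p. Poly_Mapping.keys p \<subseteq> B}"
  define E where "E y p = lin_fun (\<lambda>x. \<psi> x y) p" for y p
  have E: "E y (p + q) = E y p + E y q" "E y (p - q) = E y p - E y q" "E y (scale c p) = c * E y p"
    "E y 0 = 0" for y p q c
    by (simp_all add: E_def lin_fun_add lin_fun_diff lin_fun_scale)
  have subK: "free.subspace K" unfolding K_def by (rule subspace_keys)
  have spanT: "t \<in> K" "y \<in> \<Omega> \<Longrightarrow> E y t = 0" if "t \<in> free.span T" for t y
  proof -
    have "free.span T \<subseteq> K"
      by (rule free.span_minimal[OF _ subK]) (use T in \<open>simp add: K_def subset_iff\<close>)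
    then show "t \<in> K" using that by blast
    have "free.span T \<subseteq> {p. E y p = 0}" if "y \<in> \<Omega>"
      using kill[OF _ that] unfolding E_def by (intro free.span_minimal subspace_lin_fun) blast
    then show "y \<in> \<Omega> \<Longrightarrow> E y t = 0" using \<open>t \<in> free.span T\<close> by blast
  qed
  have spanK: "p \<in> free.span (T \<union> basis_elt ` e ` R)" if "p \<in> K" for p
  proof -
    have "(\<Sum>x\<in>Poly_Mapping.keys p. scale (Poly_Mapping.lookup p x) (basis_elt x)) \<in>
        free.span (T \<union> basis_elt ` e ` R)"
      using that span by (intro free.span_sum free.span_scale) (auto simp: K_def)
    then show ?thesis using sum_basis_elt[of p] by simp
  qed
  have kernel: "p \<in> free.span T" if "p \<in> K" and p0: "\<And>y. y \<in> R \<Longrightarrow> E y p = 0" for p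
  proof -
    obtain t s where ts: "p = t + s" "t \<in> free.span T" "s \<in> free.span (basis_elt ` e ` R)"
      using spanK[OF \<open>p \<in> K\<close>] unfolding free.span_Un by blast
    have "free.span (basis_elt ` e ` R) \<subseteq> {p. Poly_Mapping.keys p \<subseteq> e ` R}"
      by (rule free.span_minimal[OF _ subspace_keys]) auto
    then have ks: "Poly_Mapping.keys s \<subseteq> e ` R" using ts by auto
    have "Poly_Mapping.keys s = {}"
    proof (rule ccontr)
      assume "Poly_Mapping.keys s \<noteq> {}"
      then obtain y where y: "y \<in> R" "e y \<in> Poly_Mapping.keys s" using ks by blast
      \<comment> \<open>If two points shared a generator, duality at y would give it both values 0
        and 1.\<close>
      have inj: "y' = y" if "y' \<in> R" "e y' = e y" for y'
        using dual[OF \<open>y' \<in> R\<close> y(1)] dual[OF y(1) y(1)] that by (simp split: if_splits)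
      have "E y s = (\<Sum>x\<in>Poly_Mapping.keys s. if x = e y then Poly_Mapping.lookup s x else 0)"
        unfolding E_def lin_fun_def
        using ks dual[OF _ y(1)] inj by (intro sum.cong) (auto split: if_splits)
      also have "\<dots> \<noteq> 0" using y by (simp add: in_keys_iff)
      finally show False using p0[OF y(1)] spanT(2)[OF ts(2), of y] ts(1) y(1) R E by auto
    qed
    then show ?thesis using ts by simp
  qed
  have in_coset: "q \<in> coset T p \<longleftrightarrow> q - p \<in> free.span T" for p q
    unfolding coset_def by (auto simp: image_iff) (metis add_diff_cancel_left' diff_add_cancel add.commute)
  have coset_eqI: "coset T p = coset T q" if "p - q \<in> free.span T" for p q
  proof -
    have "r - p \<in> free.span T \<longleftrightarrow> r - q \<in> free.span T" for r
      using free.span_add[OF _ that, of "r - p"] free.span_diff[OF _ that, of "r - q"] by auto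
    then show ?thesis using in_coset by blast
  qed
  have coset_self: "p \<in> coset T p" for p using in_coset[of p p] by (simp add: free.span_zero)
  have UN_coset: "(\<Union>q\<in>coset T p. coset T (F q)) = coset T (F p)"
    if "\<And>q. q - p \<in> free.span T \<Longrightarrow> F q - F p \<in> free.span T" for F :: "('x \<Rightarrow>\<^sub>0 'f) \<Rightarrow> _" and p
  proof -
    have "coset T (F q) = coset T (F p)" if "q \<in> coset T p" for q
      using that in_coset \<open>\<And>q. q - p \<in> free.span T \<Longrightarrow> F q - F p \<in> free.span T\<close> by (intro coset_eqI) auto
    then have "(\<Union>q\<in>coset T p. coset T (F q)) = (\<Union>q\<in>coset T p. coset T (F p))"
      by (rule SUP_cong[OF refl])
    then show ?thesis using coset_self[of p] by blast
  qed
  have K_diff: "q \<in> K" if "q - p \<in> K" "p \<in> K" for p q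
    using free.subspace_add[OF subK that] by simp
  have lin: "lin_ext (b g) p \<in> K" "y \<in> \<Omega> \<Longrightarrow> E y (lin_ext (b g) p) = E (\<tau> g y) p"
    if "g \<in> carrier G" "p \<in> K" for g p y
  proof -
    show "lin_ext (b g) p \<in> K" using that b keys_lin_ext[of p B "b g"] by (auto simp: K_def)
    assume "y \<in> \<Omega>"
    then show "E y (lin_ext (b g) p) = E (\<tau> g y) p"
      unfolding E_def lin_fun_lin_ext unfolding lin_fun_def o_def
      using that \<psi>_b by (intro sum.cong) (auto simp: K_def)
  qed
  have V: "carrier ?V = coset T ` K" "\<zero>\<^bsub>?V\<^esub> = coset T 0"
    by (simp_all add: free_quotient_def K_def coset_def)
  have V_add: "coset T p \<oplus>\<^bsub>?V\<^esub> coset T q = coset T (p + q)" for p q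
  proof -
    have "coset T p \<oplus>\<^bsub>?V\<^esub> coset T q = {x + y | x y. x \<in> coset T p \<and> y \<in> coset T q}"
      by (simp add: free_quotient_def)
    also have "\<dots> = coset T (p + q)"
    proof (intro equalityI subsetI)
      fix z assume "z \<in> {x + y | x y. x \<in> coset T p \<and> y \<in> coset T q}"
      then obtain x y where "z = x + y" "x - p \<in> free.span T" "y - q \<in> free.span T"
        using in_coset by auto
      then have "z - (p + q) \<in> free.span T" using free.span_add[of "x - p" T "y - q"] by (simp add: algebra_simps)
      then show "z \<in> coset T (p + q)" using in_coset by simp
    next
      fix z assume "z \<in> coset T (p + q)"
      then have "z - q \<in> coset T p" using in_coset[of "z - q" p] in_coset[of z "p + q"] by (simp add: algebra_simps)
      then show "z \<in> {x + y | x y. x \<in> coset T p \<and> y \<in> coset T q}"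
        using coset_self[of q] by (intro CollectI exI[of _ "z - q"] exI[of _ q]) auto
    qed
    finally show ?thesis .
  qed
  have scale_diff: "scale c (p - q) = scale c p - scale c q" for c and p q :: "'x \<Rightarrow>\<^sub>0 'f"
    by (rule free.scale_right_diff_distrib)
  have V_smult: "c \<odot>\<^bsub>?V\<^esub> coset T p = coset T (scale c p)" for c p
    by (simp add: free_quotient_def, rule UN_coset) (metis scale_diff free.span_scale)
  \<comment> \<open>Independence of the representative: after acting by g, evaluation at y is
    evaluation at \<open>\<tau> g y\<close>, which vanishes on the span of \<open>T\<close>;
    \<open>kernel\<close> converts this back into membership in the span.\<close>
  have V_act: "act ?V g (coset T p) = coset T (lin_ext (b g) p)" if "g \<in> carrier G" "p \<in> K" for g p
  proof (simp add: free_quotient_def, rule UN_coset)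
    fix q assume q: "q - p \<in> free.span T"
    then have "q \<in> K" using spanT(1) K_diff that by blast
    then show "lin_ext (b g) q - lin_ext (b g) p \<in> free.span T"
      using that q lin R spanT(2)[OF q] \<tau>_closed E(2)
      by (intro kernel free.subspace_diff[OF subK]) (auto simp: subset_iff)
  qed
  \<comment> \<open>The choice of representative is harmless at points of \<Omega>, where evaluation
    vanishes on the span of \<open>T\<close>.\<close>
  define \<theta> where "\<theta> A y = E y (SOME p. p \<in> A)" for A y
  have \<theta>: "\<theta> (coset T p) y = E y p" if "y \<in> \<Omega>" for p y
  proof -
    have "(SOME q. q \<in> coset T p) \<in> coset T p" using coset_self by (rule someI)
    then show ?thesis unfolding \<theta>_def in_coset using spanT(2)[OF _ that] E(2) by fastforce
  qed
  have K: "0 \<in> K" "p \<in> K \<Longrightarrow> q \<in> K \<Longrightarrow> p + q \<in> K" "p \<in> K \<Longrightarrow> scale c p \<in> K" for p q c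
    using subK by (auto simp: free.subspace_def)
  have eK: "basis_elt (e y) \<in> K" if "y \<in> R" for y using e[OF that] by (simp add: K_def)
  have "realization G ?V \<Omega> \<tau> \<theta> R (\<lambda>y. coset T (basis_elt (e y)))"
  proof (intro realization.intro realization_axioms.intro G R)
    show "v = w" if vw: "v \<in> carrier ?V" "w \<in> carrier ?V" "\<And>x. x \<in> \<Omega> \<Longrightarrow> \<theta> v x = \<theta> w x" for v w
    proof -
      obtain p q where pq: "v = coset T p" "w = coset T q" "p \<in> K" "q \<in> K"
        using vw(1,2) unfolding V by blast
      have "E x (p - q) = 0" if "x \<in> R" for x
        using vw(3)[of x] that R \<theta> by (auto simp: pq E)
      then have "p - q \<in> free.span T"
        using pq by (intro kernel free.subspace_diff[OF subK])
      then show ?thesis unfolding pq by (rule coset_eqI)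
    qed
    show "P v" if v: "v \<in> carrier ?V" and P0: "P \<zero>\<^bsub>?V\<^esub>"
      and Pe: "\<And>y. y \<in> R \<Longrightarrow> P (coset T (basis_elt (e y)))"
      and Padd: "\<And>v w. v \<in> carrier ?V \<Longrightarrow> w \<in> carrier ?V \<Longrightarrow> P v \<Longrightarrow> P w \<Longrightarrow> P (v \<oplus>\<^bsub>?V\<^esub> w)"
      and Psmult: "\<And>c v. v \<in> carrier ?V \<Longrightarrow> P v \<Longrightarrow> P (c \<odot>\<^bsub>?V\<^esub> v)" for P v
    proof -
      obtain p where p: "v = coset T p" "p \<in> K" using v unfolding V by blast
      let ?C = "{p \<in> K. P (coset T p)}"
      \<comment> \<open>The relations have the zero coset, so \<open>P\<close> at zero covers them,
        and the remaining spanning vectors are covered by \<open>Pe\<close>.\<close>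
      have "free.span (T \<union> basis_elt ` e ` R) \<subseteq> ?C"
      proof (rule free.span_minimal)
        show "free.subspace ?C"
        proof (rule free.subspaceI)
          show "0 \<in> ?C" using P0 V K by simp
          show "p + q \<in> ?C" if "p \<in> ?C" "q \<in> ?C" for p q
            using that Padd[of "coset T p" "coset T q"] V V_add K by auto
          show "scale c p \<in> ?C" if "p \<in> ?C" for c p
            using that Psmult[of "coset T p" c] V V_smult K by auto
        qed
        have "coset T t = coset T 0" if "t \<in> T" for t
          using that by (intro coset_eqI) (simp add: free.span_base)
        moreover have "t \<in> K" if "t \<in> T" for t
          using T[OF that] by (simp add: K_def)
        ultimately show "T \<union> basis_elt ` e ` R \<subseteq> ?C"
          using P0 V Pe eK by auto
      qed
      then show ?thesis using spanK p by auto
    qed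
    show "\<zero>\<^bsub>?V\<^esub> \<in> carrier ?V" "\<And>y. y \<in> R \<Longrightarrow> coset T (basis_elt (e y)) \<in> carrier ?V"
      using K eK by (simp_all add: V)
    show "v \<oplus>\<^bsub>?V\<^esub> w \<in> carrier ?V" if "v \<in> carrier ?V" "w \<in> carrier ?V" for v w
      using that unfolding V by (auto simp: V_add K)
    show "c \<odot>\<^bsub>?V\<^esub> v \<in> carrier ?V" if "v \<in> carrier ?V" for v c
      using that unfolding V by (auto simp: V_smult K)
    show "act ?V g v \<in> carrier ?V" if "g \<in> carrier G" "v \<in> carrier ?V" for g v
      using that unfolding V by (auto simp: V_act lin)
    show "\<theta> \<zero>\<^bsub>?V\<^esub> x = 0" if "x \<in> \<Omega>" for x
      using that by (simp add: V \<theta> E)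
    show "\<theta> (v \<oplus>\<^bsub>?V\<^esub> w) x = \<theta> v x + \<theta> w x" if "v \<in> carrier ?V" "w \<in> carrier ?V" "x \<in> \<Omega>" for v w x
      using that unfolding V by (auto simp: V_add \<theta> E)
    show "\<theta> (c \<odot>\<^bsub>?V\<^esub> v) x = c * \<theta> v x" if "v \<in> carrier ?V" "x \<in> \<Omega>" for v x c
      using that unfolding V by (auto simp: V_smult \<theta> E)
    show "\<theta> (act ?V g v) x = \<theta> v (\<tau> g x)" if "g \<in> carrier G" "v \<in> carrier ?V" "x \<in> \<Omega>" for g v x
      using that unfolding V by (auto simp: V_act \<theta> lin \<tau>_closed)
    show "\<theta> (coset T (basis_elt (e y))) y' = (if y = y' then 1 else 0)" if "y \<in> R" "y' \<in> R" for y y'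
    proof -
      have "y' \<in> \<Omega>" using that R by blast
      then show ?thesis using dual[OF that] by (simp add: \<theta> E_def)
    qed
  qed (fact \<tau>_closed \<tau>_one \<tau>_mult)+
  moreover have "\<forall>y\<in>R. \<forall>x\<in>\<Omega>. \<theta> (coset T (basis_elt (e y))) x = \<psi> (e y) x"
    by (simp add: \<theta> E_def)
  ultimately show ?thesis by blast
qed

section \<open>Group algebras and induced modules\<close>

lemma lin_fun_galg_mult:
  "lin_fun \<phi> (galg_mult G a b) = (\<Sum>g\<in>Poly_Mapping.keys a. \<Sum>h\<in>Poly_Mapping.keys b.
     Poly_Mapping.lookup a g * Poly_Mapping.lookup b h * \<phi> (g \<otimes>\<^bsub>G\<^esub> h))"
  by (simp add: galg_mult_def lin_fun_sum lin_fun_single)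

lemma galg_mult_single:
  "galg_mult G (basis_elt g) (Poly_Mapping.single h c) = scale c (basis_elt (g \<otimes>\<^bsub>G\<^esub> h) :: _ \<Rightarrow>\<^sub>0 'f::field)"
  by (simp add: galg_mult_def scale_basis_elt) (simp add: basis_elt_def)

lemma galg_mult_closed:
  assumes "group G" "a \<in> galg (carrier G)" "b \<in> galg (carrier G)"
  shows "galg_mult G a b \<in> galg (carrier G)"
proof -
  interpret group G by fact
  have sub: "free.subspace (galg (carrier G))" unfolding galg_def by (rule subspace_keys)
  show ?thesis
    unfolding galg_mult_def
    using assms(2,3) by (intro free.subspace_sum[OF sub]) (auto simp: galg_def)
qed

lemma galg_act_char_module:
  "galg_act (char_module \<chi>) a w = lin_fun \<chi> a * w"
proof -
  let ?W = "char_module \<chi>"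
  interpret abelian_monoid ?W
    by (rule abelian_monoidI) (auto simp: char_module_def)
  have sum: "finsum ?W f A = sum f A" if "finite A" for f A
    using that
  proof (induction A)
    case empty
    show ?case by (simp add: finsum_empty) (simp add: char_module_def)
  next
    case (insert x A)
    then show ?case by (subst finsum_insert) (auto simp: char_module_def)
  qed
  have "galg_act ?W a w = (\<Sum>h\<in>Poly_Mapping.keys a. Poly_Mapping.lookup a h \<odot>\<^bsub>?W\<^esub> act ?W h w)"
    unfolding galg_act_def by (rule sum) simp
  also have "\<dots> = (\<Sum>h\<in>Poly_Mapping.keys a. Poly_Mapping.lookup a h * (\<chi> h * w))"
    by (simp add: char_module_def)
  finally show ?thesis by (simp add: lin_fun_def sum_distrib_right mult.assoc)
qed

text \<open>\<open>g \<otimes> w\<close> is the function \<open>x \<mapsto> w \<chi>0 (x g)\<close>, where \<open>\<chi>0\<close> extends the character \<open>\<chi>\<close> of \<open>H\<close> by zero;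
  \<open>R\<close> represents the right cosets of \<open>H\<close>.\<close>

lemma ind_realization:
  fixes \<chi> \<chi>0 :: "'g \<Rightarrow> 'f::field"
  assumes G: "group G" and H: "subgroup H G"
    and \<chi>: "\<And>h. h \<in> H \<Longrightarrow> \<chi> h = \<chi>0 h"
    and one: "\<chi>0 \<one>\<^bsub>G\<^esub> = 1"
    and mult: "\<And>g h. g \<in> carrier G \<Longrightarrow> h \<in> H \<Longrightarrow> \<chi>0 (g \<otimes>\<^bsub>G\<^esub> h) = \<chi>0 g * \<chi>0 h"
    and R: "R \<subseteq> carrier G"
    and dual: "\<And>y y'. y \<in> R \<Longrightarrow> y' \<in> R \<Longrightarrow> y \<noteq> y' \<Longrightarrow> \<chi>0 (y \<otimes>\<^bsub>G\<^esub> inv\<^bsub>G\<^esub> y') = 0"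
    and decomp: "\<And>g. g \<in> carrier G \<Longrightarrow> \<exists>h\<in>H. \<exists>y\<in>R. g = h \<otimes>\<^bsub>G\<^esub> y"
  shows "\<exists>\<theta> e. realization G (ind G H (char_module \<chi>)) (carrier G) (\<lambda>g x. x \<otimes>\<^bsub>G\<^esub> g) \<theta> R e \<and>
    (\<forall>y\<in>R. \<forall>x\<in>carrier G. \<theta> (e y) x = \<chi>0 (x \<otimes>\<^bsub>G\<^esub> inv\<^bsub>G\<^esub> y))"
proof -
  interpret group G by fact
  interpret H: subgroup H G by fact
  let ?W = "char_module \<chi>"
  let ?B = "galg (carrier G) \<times> carrier ?W"
  let ?T = "ind_relations G H ?W"
  \<comment> \<open>The function of a \<otimes> w, extended linearly in a from that of a single
    group element.\<close>
  define \<psi> where "\<psi> = (\<lambda>(a, w) x. w * lin_fun (\<lambda>g. \<chi>0 (x \<otimes>\<^bsub>G\<^esub> g)) a)"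
  \<comment> \<open>The inverse is needed because y^{-1} \<otimes> 1 becomes x \<mapsto> \<chi>0 (x
    y^{-1}), which is 1 at y.\<close>
  define e where "e y = (basis_elt (inv\<^bsub>G\<^esub> y) :: 'g \<Rightarrow>\<^sub>0 'f, 1 :: 'f)" for y
  have W: "carrier ?W = UNIV" "add ?W = (+)" by (simp_all add: char_module_def)
  have sub: "free.subspace (galg (carrier G) :: ('g \<Rightarrow>\<^sub>0 'f) set)" unfolding galg_def by (rule subspace_keys)
  have galgH: "galg H \<subseteq> galg (carrier G)" using H.subset by (auto simp: galg_def)
  note closed = free.subspace_add[OF sub] free.subspace_scale[OF sub] galg_mult_closed[OF G]
  have basisB: "basis_elt g \<in> galg (carrier G)" if "g \<in> carrier G" for g
    using that by (simp add: galg_def)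
  have "\<exists>\<theta> e'. realization G (free_quotient ?B ?T (\<lambda>g (x, w). (galg_mult G (basis_elt g) x, w)))
      (carrier G) (\<lambda>g x. x \<otimes>\<^bsub>G\<^esub> g) \<theta> R e' \<and> (\<forall>y\<in>R. \<forall>x\<in>carrier G. \<theta> (e' y) x = \<psi> (e y) x)"
  proof (rule free_quotient_realization)
    show "group G" "R \<subseteq> carrier G" by fact+
    show "e y \<in> ?B" if "y \<in> R" for y
      using that R by (auto simp: e_def W basisB)
    show "\<psi> (e y) y' = (if y = y' then 1 else 0)" if "y \<in> R" "y' \<in> R" for y y'
      using that R dual[of y' y] one by (auto simp: e_def \<psi>_def)
    show "Poly_Mapping.keys t \<subseteq> ?B" if "t \<in> ?T" for t
      using that unfolding ind_relations_def
      by (elim UnE CollectE exE conjE; hypsubst)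
        (intro keys_diff_subset keys_scale_subset keys_basis_subset SigmaI closed;
          use galgH in \<open>auto simp: W\<close>)+
    show "lin_fun (\<lambda>x. \<psi> x y) t = 0" if t: "t \<in> ?T" and y: "y \<in> carrier G" for t y
    proof -
      \<comment> \<open>For the balancing relation: right multiplicativity of \<chi>0 along H
        factors the functional of a convolution. The other relations are plain linearity.\<close>
      have "lin_fun (\<lambda>g. \<chi>0 (y \<otimes>\<^bsub>G\<^esub> g)) (galg_mult G x a) = lin_fun (\<lambda>g. \<chi>0 (y \<otimes>\<^bsub>G\<^esub> g)) x * lin_fun \<chi> a"
        if "x \<in> galg (carrier G)" "a \<in> galg H" for x a
      proof -
        have "\<chi>0 (y \<otimes>\<^bsub>G\<^esub> (g \<otimes>\<^bsub>G\<^esub> h)) = \<chi>0 (y \<otimes>\<^bsub>G\<^esub> g) * \<chi> h"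
          if "g \<in> Poly_Mapping.keys x" "h \<in> Poly_Mapping.keys a" for g h
        proof -
          have "g \<in> carrier G" "h \<in> H"
            using that \<open>x \<in> galg (carrier G)\<close> \<open>a \<in> galg H\<close> by (auto simp: galg_def)
          then show ?thesis using y mult[of "y \<otimes>\<^bsub>G\<^esub> g" h] \<chi>[of h] by (simp add: m_assoc)
        qed
        then have "lin_fun (\<lambda>g. \<chi>0 (y \<otimes>\<^bsub>G\<^esub> g)) (galg_mult G x a) =
          (\<Sum>g\<in>Poly_Mapping.keys x. \<Sum>h\<in>Poly_Mapping.keys a.
            (Poly_Mapping.lookup x g * \<chi>0 (y \<otimes>\<^bsub>G\<^esub> g)) * (Poly_Mapping.lookup a h * \<chi> h))"
          unfolding lin_fun_galg_mult by (intro sum.cong) auto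
        then show ?thesis unfolding lin_fun_def sum_product .
      qed
      then show ?thesis
        using t unfolding ind_relations_def
        by (elim UnE CollectE exE conjE; hypsubst)
          (simp_all add: lin_fun_diff lin_fun_add lin_fun_scale \<psi>_def W galg_act_char_module algebra_simps)
    qed
    show "(case x of (x, w) \<Rightarrow> (galg_mult G (basis_elt g) x, w)) \<in> ?B" if "g \<in> carrier G" "x \<in> ?B" for g x
      using that by (auto intro!: closed basisB)
    show "\<psi> (case x of (x, w) \<Rightarrow> (galg_mult G (basis_elt g) x, w)) y = \<psi> x (y \<otimes>\<^bsub>G\<^esub> g)"
      if "g \<in> carrier G" "x \<in> ?B" "y \<in> carrier G" for g x y
    proof -
      obtain a w where x: "x = (a, w)" by (cases x)
      have "\<chi>0 (y \<otimes>\<^bsub>G\<^esub> (g \<otimes>\<^bsub>G\<^esub> h)) = \<chi>0 (y \<otimes>\<^bsub>G\<^esub> g \<otimes>\<^bsub>G\<^esub> h)" if "h \<in> Poly_Mapping.keys a" for h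
        using that \<open>g \<in> carrier G\<close> \<open>x \<in> ?B\<close> \<open>y \<in> carrier G\<close> x by (subst m_assoc) (auto simp: galg_def)
      then show ?thesis
        by (simp add: x \<psi>_def lin_fun_galg_mult) (simp add: lin_fun_def basis_elt_def)
    qed
    let ?S = "free.span (?T \<union> basis_elt ` e ` R)"
    have via: "basis_elt u \<in> ?S" if "basis_elt u - s \<in> ?T" "s \<in> ?S" for u s
      using free.span_add[of "basis_elt u - s" "?T \<union> basis_elt ` e ` R" s] that
      by (simp add: free.span_base)
    have rel_add: "basis_elt (x + y, w) - basis_elt (x, w) - basis_elt (y, w) \<in> ?T"
      if "x \<in> galg (carrier G)" "y \<in> galg (carrier G)" for x y w
      using that unfolding ind_relations_def W by blast
    have rel_scale: "basis_elt (scale c x, w) - scale c (basis_elt (x, w)) \<in> ?T"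
      if "x \<in> galg (carrier G)" for c x w
      using that unfolding ind_relations_def W by blast
    have rel_mult: "basis_elt (galg_mult G x a, w) - basis_elt (x, lin_fun \<chi> a * w) \<in> ?T"
      if "x \<in> galg (carrier G)" "a \<in> galg H" for x a w
      using that unfolding ind_relations_def W galg_act_char_module by blast
    have step1: "basis_elt (scale c x, w) \<in> ?S" if "basis_elt (x, w) \<in> ?S" "x \<in> galg (carrier G)" for c x w
      by (rule via[OF rel_scale[OF that(2)] free.span_scale[OF that(1)]])
    have step2: "basis_elt (x, lin_fun \<chi> a * w) \<in> ?S"
      if "basis_elt (galg_mult G x a, w) \<in> ?S" "x \<in> galg (carrier G)" "a \<in> galg H" for x a w
      using free.span_diff[OF that(1) free.span_base[OF UnI1[OF rel_mult[OF that(2,3), of w]]]] by simp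
    have step3: "basis_elt (galg_mult G x a, w) \<in> ?S"
      if "basis_elt (x, lin_fun \<chi> a * w) \<in> ?S" "x \<in> galg (carrier G)" "a \<in> galg H" for x a w
      by (rule via[OF rel_mult[OF that(2,3)] that(1)])
    \<comment> \<open>The basis vectors carry only the scalar 1. A scalar c enters on the left as a
      multiple in FG and crosses to the right as c times the identity, an element of FH.\<close>
    have R_in: "basis_elt (basis_elt (inv\<^bsub>G\<^esub> y), c) \<in> ?S" if "y \<in> R" for y c
    proof -
      have y: "inv\<^bsub>G\<^esub> y \<in> carrier G" using that R by auto
      let ?a = "Poly_Mapping.single \<one>\<^bsub>G\<^esub> c"
      have "basis_elt (basis_elt (inv\<^bsub>G\<^esub> y), 1) \<in> ?S"
        using that by (intro free.span_base) (auto simp: e_def)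
      then have "basis_elt (scale c (basis_elt (inv\<^bsub>G\<^esub> y)), 1) \<in> ?S"
        using y by (intro step1 basisB)
      then have "basis_elt (basis_elt (inv\<^bsub>G\<^esub> y), lin_fun \<chi> ?a * 1) \<in> ?S"
        using y by (intro step2 basisB) (auto simp: galg_mult_single galg_def split: if_splits)
      then show ?thesis using \<chi>[of "\<one>\<^bsub>G\<^esub>"] one by (simp add: lin_fun_single)
    qed
    \<comment> \<open>Decomposing g^{-1} = h y gives g = y^{-1} h^{-1}, and the factor from H is
      moved across the tensor sign.\<close>
    have g_in: "basis_elt (basis_elt g, w) \<in> ?S" if "g \<in> carrier G" for g w
    proof -
      obtain h y where hy: "h \<in> H" "y \<in> R" "inv\<^bsub>G\<^esub> g = h \<otimes>\<^bsub>G\<^esub> y" 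
        using decomp[of "inv\<^bsub>G\<^esub> g"] \<open>g \<in> carrier G\<close> by auto
      then have g: "g = inv\<^bsub>G\<^esub> y \<otimes>\<^bsub>G\<^esub> inv\<^bsub>G\<^esub> h"
        using that R H.subset by (metis inv_inv inv_mult_group subsetD)
      have "basis_elt (galg_mult G (basis_elt (inv\<^bsub>G\<^esub> y)) (basis_elt (inv\<^bsub>G\<^esub> h)), w) \<in> ?S"
        using hy R by (intro step3 R_in basisB) (auto simp: galg_def)
      then show ?thesis using galg_mult_single[of G "inv\<^bsub>G\<^esub> y" "inv\<^bsub>G\<^esub> h" "1::'f"]
        by (simp add: g scale_basis_elt flip: basis_elt_def)
    qed
    show "basis_elt x \<in> ?S" if "x \<in> ?B" for x
    proof -
      obtain a w where x: "x = (a, w)" "a \<in> galg (carrier G)" using \<open>x \<in> ?B\<close> by auto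
      let ?C = "{a \<in> galg (carrier G). basis_elt (a, w) \<in> ?S}"
      have "a \<in> free.span (basis_elt ` carrier G)"
        using x(2) by (subst sum_basis_elt, intro free.span_sum free.span_scale free.span_base) (auto simp: galg_def)
      also have "free.span (basis_elt ` carrier G) \<subseteq> ?C"
      proof (rule free.span_minimal)
        show "free.subspace ?C"
        proof (rule free.subspaceI)
          show scale: "scale c a \<in> ?C" if "a \<in> ?C" for c a
            using that step1 closed by auto
          show "a + a' \<in> ?C" if "a \<in> ?C" "a' \<in> ?C" for a a'
          proof -
            have "basis_elt (a + a', w) - (basis_elt (a, w) + basis_elt (a', w)) \<in> ?T"
              using rel_add[of a a' w] that by (simp add: diff_diff_eq)
            then have "basis_elt (a + a', w) \<in> ?S"
              by (rule via) (rule free.span_add, use that in blast, use that in blast)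
            then show ?thesis using that closed by auto
          qed
          show "0 \<in> ?C" using scale[of "basis_elt \<one>\<^bsub>G\<^esub>" 0] g_in[OF one_closed] basisB[OF one_closed] by simp
        qed
        show "basis_elt ` carrier G \<subseteq> ?C" using g_in basisB by auto
      qed
      finally show ?thesis using x by simp
    qed
  qed (auto simp: m_assoc)
  then show ?thesis
    unfolding ind_def by (auto simp: \<psi>_def e_def)
qed

text \<open>The maps \<rho> identify \<open>R\<close> with the product of the sets
  \<open>Q i\<close>, so \<open>R\<close> indexes the tensors of basis vectors. By
  \<open>eval\<close> the i-th factor at y sees only \<open>\<rho> i y\<close>, hence the product of
  functions at a point of \<open>R\<close> is a product of Kronecker deltas, and that is
  duality.\<close>

lemma tensor_realization:
  fixes V :: "'i \<Rightarrow> ('g, 'f::field, 'v) gspace"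
  assumes I: "finite I" "I \<noteq> {}"
    and V: "\<And>i. i \<in> I \<Longrightarrow> realization G (V i) \<Omega> \<tau> (\<theta> i) (Q i) (e i)"
    and R: "R \<subseteq> \<Omega>"
    and \<rho>: "\<And>i y. i \<in> I \<Longrightarrow> y \<in> R \<Longrightarrow> \<rho> i y \<in> Q i"
    and \<rho>_inj: "\<And>y y'. y \<in> R \<Longrightarrow> y' \<in> R \<Longrightarrow> (\<And>i. i \<in> I \<Longrightarrow> \<rho> i y = \<rho> i y') \<Longrightarrow> y = y'"
    and \<rho>_surj: "\<And>s. (\<And>i. i \<in> I \<Longrightarrow> s i \<in> Q i) \<Longrightarrow> \<exists>y\<in>R. \<forall>i\<in>I. \<rho> i y = s i"
    and eval: "\<And>i s y. i \<in> I \<Longrightarrow> s \<in> Q i \<Longrightarrow> y \<in> R \<Longrightarrow> \<theta> i (e i s) y = \<theta> i (e i s) (\<rho> i y)"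
  shows "\<exists>\<theta>' e'. realization G (tensor I V) \<Omega> \<tau> \<theta>' R e' \<and>
    (\<forall>y\<in>R. \<forall>x\<in>\<Omega>. \<theta>' (e' y) x = (\<Prod>i\<in>I. \<theta> i (e i (\<rho> i y)) x))"
proof -
  let ?B = "\<Pi>\<^sub>E i\<in>I. carrier (V i)"
  let ?T = "tensor_relations I V"
  define \<psi> where "\<psi> u x = (\<Prod>i\<in>I. \<theta> i (u i) x)" for u x
  define e' where "e' y = (\<lambda>i\<in>I. e i (\<rho> i y))" for y
  note closed = realization.add_closed[OF V] realization.smult_closed[OF V] realization.act_closed[OF V]
    realization.e_closed[OF V] realization.zero_closed[OF V]
  have upd: "u(i := v) \<in> ?B" if "u \<in> ?B" "i \<in> I" "v \<in> carrier (V i)" for u i v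
    using that by (auto simp: PiE_iff extensional_def)
  have \<psi>_upd: "\<psi> (u(i := v)) x = \<theta> i v x * (\<Prod>j\<in>I - {i}. \<theta> j (u j) x)" if "i \<in> I" for u i v x
    unfolding \<psi>_def using I that by (subst prod.remove[of I i]) (auto intro: prod.cong)
  \<comment> \<open>The group and the motion of points are shared by all factors, so any single
    factor supplies their laws.\<close>
  obtain i0 where i0: "i0 \<in> I" using I by auto
  interpret V0: realization G "V i0" \<Omega> \<tau> "\<theta> i0" "Q i0" "e i0" by (rule V[OF i0])
  have "\<exists>\<theta>' e''. realization G (free_quotient ?B ?T (\<lambda>g u. \<lambda>i\<in>I. act (V i) g (u i))) \<Omega> \<tau> \<theta>' R e'' \<and>
    (\<forall>y\<in>R. \<forall>x\<in>\<Omega>. \<theta>' (e'' y) x = \<psi> (e' y) x)"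
  proof (rule free_quotient_realization)
    show "group G" by (rule V0.is_group)
    show "R \<subseteq> \<Omega>" by fact
    show e'B: "e' y \<in> ?B" if "y \<in> R" for y
      using that closed \<rho> by (auto simp: e'_def)
    show "\<psi> (e' y) y' = (if y = y' then 1 else 0)" if y: "y \<in> R" "y' \<in> R" for y y'
    proof -
      have "\<psi> (e' y) y' = (\<Prod>i\<in>I. if \<rho> i y = \<rho> i y' then 1 else 0)"
        unfolding \<psi>_def using y eval \<rho> realization.e_dual[OF V] by (intro prod.cong) (auto simp: e'_def)
      also have "\<dots> = (if \<forall>i\<in>I. \<rho> i y = \<rho> i y' then 1 else 0)"
        using I(1) by (auto simp: prod_zero_iff)
      finally show ?thesis using \<rho>_inj[OF y] by auto
    qed
    show "Poly_Mapping.keys t \<subseteq> ?B" if "t \<in> ?T" for t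
      using that unfolding tensor_relations_def
      by (elim UnE CollectE exE conjE; hypsubst)
        (intro keys_diff_subset keys_scale_subset keys_basis_subset upd closed; assumption)+
    show "lin_fun (\<lambda>x. \<psi> x y) t = 0" if t: "t \<in> ?T" and y: "y \<in> \<Omega>" for t y
      using t unfolding tensor_relations_def
      by (elim UnE CollectE exE conjE; hypsubst)
        (simp_all add: y lin_fun_diff lin_fun_scale \<psi>_upd realization.\<theta>_add[OF V] realization.\<theta>_smult[OF V] distrib_right)
    show "(\<lambda>i\<in>I. act (V i) g (u i)) \<in> ?B" if "g \<in> carrier G" "u \<in> ?B" for g u
      using that closed by (auto simp: PiE_iff)
    show "\<psi> (\<lambda>i\<in>I. act (V i) g (u i)) y = \<psi> u (\<tau> g y)" if "g \<in> carrier G" "u \<in> ?B" "y \<in> \<Omega>" for g u y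
      unfolding \<psi>_def using that by (intro prod.cong) (auto simp: realization.\<theta>_act[OF V] PiE_iff)
    let ?S = "free.span (?T \<union> basis_elt ` e' ` R)"
    have via: "basis_elt u \<in> ?S" if "basis_elt u - s \<in> ?T" "s \<in> ?S" for u s
      using free.span_add[of "basis_elt u - s" "?T \<union> basis_elt ` e' ` R" s] that
      by (simp add: free.span_base)
    \<comment> \<open>\<open>K\<close> holds the coordinates that are still arbitrary, all others
      being basis vectors; each step expands one coordinate by span induction.\<close>
    have main: "\<forall>u\<in>?B. (\<forall>i\<in>I - K. u i \<in> e i ` Q i) \<longrightarrow> basis_elt u \<in> ?S" if "finite K" "K \<subseteq> I" for K
      using that
    proof (induction K)
      case empty
      show ?case
      proof (intro ballI impI)
        fix u assume u: "u \<in> ?B" "\<forall>i\<in>I - {}. u i \<in> e i ` Q i"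
        have "\<forall>i\<in>I. \<exists>s. s \<in> Q i \<and> u i = e i s" using u(2) by blast
        then obtain s where s: "\<And>i. i \<in> I \<Longrightarrow> s i \<in> Q i" "\<And>i. i \<in> I \<Longrightarrow> u i = e i (s i)"
          unfolding bchoice_iff by blast
        obtain y where "y \<in> R" "\<forall>i\<in>I. \<rho> i y = s i" using \<rho>_surj[OF s(1)] by auto
        then have "u = e' y" using u(1) s(2) by (intro extensionalityI[of u I]) (auto simp: e'_def PiE_iff)
        then show "basis_elt u \<in> ?S" using \<open>y \<in> R\<close> by (intro free.span_base) auto
      qed
    next
      case (insert i K)
      show ?case
      proof (intro ballI impI)
        fix u assume u: "u \<in> ?B" "\<forall>j\<in>I - insert i K. u j \<in> e j ` Q j"
        have i: "i \<in> I" using insert by auto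
        have "u i \<in> carrier (V i)" using u i by auto
        then have "basis_elt (u(i := u i)) \<in> ?S"
        proof (rule realization.e_span[OF V[OF i]])
          have smult: "basis_elt (u(i := c \<odot>\<^bsub>V i\<^esub> v)) \<in> ?S"
            if "v \<in> carrier (V i)" "scale c (basis_elt (u(i := v))) \<in> ?S" for c v
          proof (rule via[OF _ that(2)])
            show "basis_elt (u(i := c \<odot>\<^bsub>V i\<^esub> v)) - scale c (basis_elt (u(i := v))) \<in> ?T"
              using that(1) u(1) i unfolding tensor_relations_def by blast
          qed
          show "basis_elt (u(i := c \<odot>\<^bsub>V i\<^esub> v)) \<in> ?S"
            if "v \<in> carrier (V i)" "basis_elt (u(i := v)) \<in> ?S" for c v
            using that by (intro smult free.span_scale)
          \<comment> \<open>The multilinearity relations have no clause for the zero vector; it is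
            reached through homogeneity with scalar 0.\<close>
          have "0 \<odot>\<^bsub>V i\<^esub> \<zero>\<^bsub>V i\<^esub> = \<zero>\<^bsub>V i\<^esub>"
            by (rule realization.\<theta>_inj[OF V[OF i]])
              (auto simp: closed i realization.\<theta>_smult[OF V] realization.\<theta>_zero[OF V])
          then show "basis_elt (u(i := \<zero>\<^bsub>V i\<^esub>)) \<in> ?S"
            using smult[of "\<zero>\<^bsub>V i\<^esub>" 0] closed(5)[OF i] by (simp add: free.span_zero)
          show "basis_elt (u(i := e i y)) \<in> ?S" if "y \<in> Q i" for y
          proof -
            have "\<forall>j\<in>I - K. (u(i := e i y)) j \<in> e j ` Q j" using u(2) that by auto
            then show ?thesis
              using insert.IH insert.prems upd[OF u(1) i closed(4)[OF i that]] by blast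
          qed
          show "basis_elt (u(i := v \<oplus>\<^bsub>V i\<^esub> w)) \<in> ?S"
            if "v \<in> carrier (V i)" "w \<in> carrier (V i)" "basis_elt (u(i := v)) \<in> ?S" "basis_elt (u(i := w)) \<in> ?S" for v w
          proof (rule via)
            show "basis_elt (u(i := v)) + basis_elt (u(i := w)) \<in> ?S" using that by (intro free.span_add)
            have "basis_elt (u(i := v \<oplus>\<^bsub>V i\<^esub> w)) - basis_elt (u(i := v)) - basis_elt (u(i := w)) \<in> ?T"
              using u(1) i that unfolding tensor_relations_def by blast
            then show "basis_elt (u(i := v \<oplus>\<^bsub>V i\<^esub> w)) - (basis_elt (u(i := v)) + basis_elt (u(i := w))) \<in> ?T"
              by (simp add: diff_diff_eq)
          qed
        qed
        then show "basis_elt u \<in> ?S" by simp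
      qed
    qed
    show "basis_elt u \<in> ?S" if "u \<in> ?B" for u
      using main[OF I(1) order_refl] that by auto
  qed (auto simp: V0.\<tau>_closed V0.\<tau>_one V0.\<tau>_mult)
  moreover have "\<psi> (e' y) x = (\<Prod>i\<in>I. \<theta> i (e i (\<rho> i y)) x)" for y x
    unfolding \<psi>_def e'_def by (intro prod.cong) auto
  ultimately show ?thesis unfolding tensor_def by simp
qed

text \<open>Functions on L are pulled back along \<pi>. Multiplicativity of \<pi> turns translation
  by g into translation by \<open>\<pi> g\<close>, and since \<pi> fixes L, separation and duality
  survive.\<close>

lemma inflate_realization:
  assumes G: "group G" and L: "L \<subseteq> carrier G"
    and V: "realization (G\<lparr>carrier := L\<rparr>) V L (\<lambda>g x. x \<otimes>\<^bsub>G\<^esub> g) \<theta> R e"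
    and \<pi>: "\<And>g. g \<in> carrier G \<Longrightarrow> \<pi> g \<in> L" "\<And>g. g \<in> L \<Longrightarrow> \<pi> g = g"
      "\<And>g h. g \<in> carrier G \<Longrightarrow> h \<in> carrier G \<Longrightarrow> \<pi> (g \<otimes>\<^bsub>G\<^esub> h) = \<pi> g \<otimes>\<^bsub>G\<^esub> \<pi> h"
    and N: "\<And>g. g \<in> carrier G \<Longrightarrow> (THE l. l \<in> L \<and> (\<exists>n\<in>N. g = n \<otimes>\<^bsub>G\<^esub> l)) = \<pi> g"
  shows "realization G (inflate G N L V) (carrier G) (\<lambda>g x. x \<otimes>\<^bsub>G\<^esub> g) (\<lambda>v x. \<theta> v (\<pi> x)) R e"
proof -
  interpret group G by fact
  interpret V: realization "G\<lparr>carrier := L\<rparr>" V L "\<lambda>g x. x \<otimes>\<^bsub>G\<^esub> g" \<theta> R e by fact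
  have V_simps: "carrier (inflate G N L V) = carrier V" "\<zero>\<^bsub>inflate G N L V\<^esub> = \<zero>\<^bsub>V\<^esub>"
    "add (inflate G N L V) = add V" "module.smult (inflate G N L V) = module.smult V"
    "g \<in> carrier G \<Longrightarrow> act (inflate G N L V) g = act V (\<pi> g)" for g
    by (simp_all add: inflate_def N)
  show ?thesis
  proof (intro realization.intro realization_axioms.intro G)
    show "v = w" if "v \<in> carrier (inflate G N L V)" "w \<in> carrier (inflate G N L V)"
      "\<And>x. x \<in> carrier G \<Longrightarrow> \<theta> v (\<pi> x) = \<theta> w (\<pi> x)" for v w
      using that L \<pi>(2) by (intro V.\<theta>_inj) (auto simp: V_simps, metis subsetD)
    show "P v" if "v \<in> carrier (inflate G N L V)" "P \<zero>\<^bsub>inflate G N L V\<^esub>" "\<And>y. y \<in> R \<Longrightarrow> P (e y)"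
      "\<And>v w. v \<in> carrier (inflate G N L V) \<Longrightarrow> w \<in> carrier (inflate G N L V) \<Longrightarrow> P v \<Longrightarrow> P w \<Longrightarrow> P (v \<oplus>\<^bsub>inflate G N L V\<^esub> w)"
      "\<And>c v. v \<in> carrier (inflate G N L V) \<Longrightarrow> P v \<Longrightarrow> P (c \<odot>\<^bsub>inflate G N L V\<^esub> v)" for P v
      using that unfolding V_simps by (rule V.e_span)
    show "R \<subseteq> carrier G" using V.R_subset L by auto
    show "\<theta> (e y) (\<pi> y') = (if y = y' then 1 else 0)" if "y \<in> R" "y' \<in> R" for y y'
      using that V.e_dual V.R_subset \<pi>(2) by auto
  qed (use \<pi> V.zero_closed V.add_closed V.smult_closed V.act_closed V.\<theta>_zero V.\<theta>_add V.\<theta>_smult V.\<theta>_act V.e_closed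
       in \<open>auto simp: V_simps m_assoc\<close>)
qed

subsection \<open>Elementary and basic modules\<close>

lemma closed_L_roots: "closed_roots (L_roots d)"
  by (cases d) (auto simp: closed_roots_def L_roots_def)

lemma L_roots_subset: "L_roots d \<subseteq> Phi"
  by (cases d) (auto simp: L_roots_def Phi_def)

lemma removed_roots_eq: "removed_roots d = {c \<in> Phi. fst c = fst d \<and> snd c < snd d}"
  by (cases d) (auto simp: removed_roots_def Phi_def)

lemma Gamma_eq: "Gamma D = {c \<in> Phi. \<forall>d\<in>D. fst c = fst d \<longrightarrow> snd d \<le> snd c}"
  by (auto simp: Gamma_def removed_roots_eq not_less)

text \<open>\<open>Gamma D\<close> bounds the column of a root from below in terms of its row, and
  composing (a, b) with (b, c) moves right within row a.\<close>

lemma closed_Gamma: "closed_roots (Gamma D)"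
  unfolding closed_roots_def
proof (intro allI impI)
  fix a b c assume "(a, b) \<in> Gamma D" "(b, c) \<in> Gamma D"
  then have "a < b" "b < c" "\<forall>d\<in>D. a = fst d \<longrightarrow> snd d \<le> b"
    by (auto simp: Gamma_eq Phi_def)
  then show "(a, c) \<in> Gamma D"
    by (auto simp: Gamma_eq Phi_def)
qed

text \<open>Exhibits P as the intersection of L with H_i, so that the elementary modules and the
  large induced module fit one construction.\<close>

lemma P_roots_eq: "P_roots d = L_roots d \<inter> Gamma {d}"
  by (cases d) (auto simp: P_roots_def L_roots_def Gamma_def removed_roots_def Phi_def)

lemma N_roots_eq: "N_roots d = Phi - L_roots d"
  by (cases d) (auto simp: N_roots_def L_roots_def Phi_def)

lemma closed_N_roots: "closed_roots (N_roots d)"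
  by (cases d) (auto simp: closed_roots_def N_roots_def Phi_def)

text \<open>This is H = \<Inter>_i H_i in coordinates: an element lies in H exactly when all its
  truncated rows vanish.\<close>

lemma supported_Gamma_iff:
  assumes "x \<in> supported Phi"
  shows "x \<in> supported (Gamma D) \<longleftrightarrow> (\<forall>d\<in>D. agree d x 0)"
proof
  assume "x \<in> supported (Gamma D)"
  then have "Poly_Mapping.lookup x (fst d, c) = 0" if "d \<in> D" "c < snd d" for d c
    by (rule supportedD) (use that in \<open>auto simp: Gamma_eq\<close>)
  then show "\<forall>d\<in>D. agree d x 0" by (simp add: agree_def)
next
  assume agree: "\<forall>d\<in>D. agree d x 0"
  have "Poly_Mapping.lookup x (a, c) = 0" if "(a, c) \<notin> Gamma D" for a c
  proof (cases "(a, c) \<in> Phi")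
    case True
    then obtain d where "d \<in> D" "a = fst d" "c < snd d"
      using \<open>(a, c) \<notin> Gamma D\<close> by (auto simp: Gamma_eq not_le)
    then show ?thesis using agree by (simp add: agree_def)
  next
    case False
    then show ?thesis by (rule supportedD[OF assms])
  qed
  then show "x \<in> supported (Gamma D)" by (simp add: supported_iff)
qed

lemma supported_Int: "x \<in> supported (\<Delta> \<inter> \<Delta>') \<longleftrightarrow> x \<in> supported \<Delta> \<and> x \<in> supported \<Delta>'"
  by (auto simp: supported_def)

text \<open>Both induced modules of the theorem are instances: \<open>\<Delta> = L_roots d\<close> with \<open>D = {d}\<close>, and
  \<open>\<Delta> = Phi\<close>.\<close>

lemma ind_McLain_realization:
  fixes D :: "('l::linorder \<times> 'l) set" and f :: "'l \<times> 'l \<Rightarrow> 'r::ring_1 \<Rightarrow> 'f::field"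
  assumes \<Delta>: "closed_roots \<Delta>" "\<Delta> \<subseteq> Phi" and D: "finite D"
    and f: "\<And>d. d \<in> D \<Longrightarrow> linear_character (f d)"
    and \<chi>: "\<And>h. h \<in> supported (\<Delta> \<inter> Gamma D) \<Longrightarrow> \<chi> h = (\<Prod>d\<in>D. f d (Poly_Mapping.lookup h d))"
  shows "\<exists>\<theta> e. realization (McLain\<lparr>carrier := M_of \<Delta>\<rparr>)
      (ind (McLain\<lparr>carrier := M_of \<Delta>\<rparr>) (M_of (\<Delta> \<inter> Gamma D)) (char_module \<chi>))
      (supported \<Delta>) (\<lambda>g x. x \<star> g) \<theta> (supported (\<Delta> - Gamma D)) e \<and>
    (\<forall>y\<in>supported (\<Delta> - Gamma D). \<forall>x\<in>supported \<Delta>. \<theta> (e y) x = (\<Prod>d\<in>D. row_char d (f d) (x \<star> minv y)))"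
proof -
  interpret group "McLain :: ('l \<times> 'l \<Rightarrow>\<^sub>0 'r) monoid" by (rule group_McLain)
  let ?G = "McLain\<lparr>carrier := supported \<Delta>\<rparr> :: ('l \<times> 'l \<Rightarrow>\<^sub>0 'r) monoid"
  let ?H = "supported (\<Delta> \<inter> Gamma D) :: ('l \<times> 'l \<Rightarrow>\<^sub>0 'r) set"
  let ?R = "supported (\<Delta> - Gamma D) :: ('l \<times> 'l \<Rightarrow>\<^sub>0 'r) set"
  define \<chi>0 where "\<chi>0 z = (\<Prod>d\<in>D. row_char d (f d) z)" for z :: "'l \<times> 'l \<Rightarrow>\<^sub>0 'r"
  have cl: "closed_roots (\<Delta> \<inter> Gamma D)"
    using \<Delta>(1) closed_Gamma[of D] unfolding closed_roots_def by blast
  have M: "M_of \<Delta> = (supported \<Delta> :: ('l \<times> 'l \<Rightarrow>\<^sub>0 'r) set)" "M_of (\<Delta> \<inter> Gamma D) = ?H"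
    using \<Delta> cl by (auto intro!: M_of_eq_supported)
  have subG: "subgroup (supported \<Delta>) (McLain :: ('l \<times> 'l \<Rightarrow>\<^sub>0 'r) monoid)"
    using subgroup_supported[OF \<Delta>] .
  have subH: "subgroup ?H McLain"
    using subgroup_supported[OF cl] \<Delta>(2) by blast
  have Phi: "x \<in> supported Phi" if "x \<in> supported \<Delta>" for x :: "'l \<times> 'l \<Rightarrow>\<^sub>0 'r"
    using that supported_mono[OF \<Delta>(2)] by blast
  have R\<Delta>: "?R \<subseteq> supported \<Delta>" and H\<Delta>: "?H \<subseteq> supported \<Delta>"
    by (auto intro!: supported_mono)
  have H_iff: "x \<in> ?H \<longleftrightarrow> (\<forall>d\<in>D. agree d x 0)" if "x \<in> supported \<Delta>" for x
    using that supported_Gamma_iff[OF Phi[OF that], of D] by (simp add: supported_Int)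
  have inv: "inv\<^bsub>?G\<^esub> x = minv x" if "x \<in> supported \<Delta>" for x
    by (rule m_inv_consistent[OF subG that])
  have mcl: "x \<star> y \<in> supported \<Delta>" "minv x \<in> supported \<Delta>" if "x \<in> supported \<Delta>" "y \<in> supported \<Delta>"
    for x y :: "'l \<times> 'l \<Rightarrow>\<^sub>0 'r"
    using that subG by (auto intro: subgroup.m_closed subgroup.m_inv_closed)
  \<comment> \<open>A root of \<Delta> outside \<open>Gamma D\<close> lies in one of the truncated
    rows, so these rows determine an element of \<open>?R\<close>.\<close>
  have R_eq: "y = y'" if "y \<in> ?R" "y' \<in> ?R" "\<And>d. d \<in> D \<Longrightarrow> agree d y y'" for y y'
  proof (rule poly_mapping_eqI)
    fix k
    show "Poly_Mapping.lookup y k = Poly_Mapping.lookup y' k"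
    proof (cases "k \<in> \<Delta> - Gamma D")
      case True
      then obtain d where "d \<in> D" "fst k = fst d" "snd k < snd d"
        using \<Delta>(2) unfolding Gamma_def removed_roots_eq by blast
      then show ?thesis using that(3)[of d] unfolding agree_def by (metis prod.collapse)
    next
      case False
      then show ?thesis using that(1,2) supportedD by metis
    qed
  qed
  have zero_row: "row_char d \<mu> 0 = 1" if "linear_character \<mu>" for d :: "'l \<times> 'l" and \<mu> :: "'r \<Rightarrow> 'f"
    using linear_character_zero[OF that] by (simp add: row_char_def)
  have H_\<chi>0: "\<chi>0 h = (\<Prod>d\<in>D. f d (Poly_Mapping.lookup h d))" if "h \<in> ?H" for h
    unfolding \<chi>0_def using that H_iff H\<Delta> by (intro prod.cong) (auto simp: row_char_def)
  have "\<exists>\<theta> e. realization ?G (ind ?G ?H (char_module \<chi>)) (carrier ?G) (\<lambda>g x. x \<otimes>\<^bsub>?G\<^esub> g) \<theta> ?R e \<and>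
    (\<forall>y\<in>?R. \<forall>x\<in>carrier ?G. \<theta> (e y) x = \<chi>0 (x \<otimes>\<^bsub>?G\<^esub> inv\<^bsub>?G\<^esub> y))"
  proof (rule ind_realization)
    show "group ?G" using subgroup.subgroup_is_group[OF subG is_group] .
    show "subgroup ?H ?G"
      using subgroup_incl[OF subH subG H\<Delta>] .
    show "\<chi> h = \<chi>0 h" if "h \<in> ?H" for h
      using \<chi>[OF that] H_\<chi>0[OF that] by simp
    show "\<chi>0 \<one>\<^bsub>?G\<^esub> = 1" by (simp add: \<chi>0_def McLain_simps zero_row f)
    show "\<chi>0 (g \<otimes>\<^bsub>?G\<^esub> h) = \<chi>0 g * \<chi>0 h" if "g \<in> carrier ?G" "h \<in> ?H" for g h
    proof -
      have "h \<in> supported \<Delta>" using that H\<Delta> by blast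
      then have "row_char d (f d) (g \<star> h) = row_char d (f d) g * f d (Poly_Mapping.lookup h d)" if "d \<in> D" for d
        using \<open>g \<in> carrier ?G\<close> \<open>h \<in> ?H\<close> H_iff[of h] that Phi by (intro row_char_mult f) auto
      then show ?thesis
        using H_\<chi>0[OF that(2)] by (simp add: \<chi>0_def prod.distrib)
    qed
    show "?R \<subseteq> carrier ?G" using R\<Delta> by simp
    show "\<chi>0 (y \<otimes>\<^bsub>?G\<^esub> inv\<^bsub>?G\<^esub> y') = 0" if y: "y \<in> ?R" "y' \<in> ?R" "y \<noteq> y'" for y y'
    proof -
      have y\<Delta>: "y \<in> supported \<Delta>" "y' \<in> supported \<Delta>" using y R\<Delta> by auto
      then have yPhi: "y \<in> supported Phi" "y' \<in> supported Phi" using Phi by auto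
      obtain d where d: "d \<in> D" "\<not> agree d y y'" using R_eq y by blast
      have "\<not> agree d (y \<star> minv y') 0"
      proof
        assume "agree d (y \<star> minv y') 0"
        then have "agree d (y \<star> minv y') (y' \<star> minv y')" using yPhi by (simp add: mmult_minv)
        then show False using d(2) agree_mmult_cancel yPhi minv_supported by blast
      qed
      then show ?thesis using d(1) D inv[OF y\<Delta>(2)] by (auto simp: \<chi>0_def row_char_def intro!: prod_zero)
    qed
    show "\<exists>h\<in>?H. \<exists>y\<in>?R. g = h \<otimes>\<^bsub>?G\<^esub> y" if "g \<in> carrier ?G" for g
    proof -
      have g: "g \<in> supported \<Delta>" "g \<in> supported Phi" using that Phi by auto
      \<comment> \<open>Erasing all entries outside the truncated rows leaves these rows unchanged,
        so g and y lie in the same right coset.\<close>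
      define y where "y = restr (\<Delta> - Gamma D) g"
      have y: "y \<in> ?R" by (auto simp: y_def supported_def keys_restr)
      then have y': "y \<in> supported \<Delta>" "y \<in> supported Phi" using R\<Delta> Phi by auto
      have agree: "agree d g y" if "d \<in> D" for d
        unfolding agree_def
      proof (intro allI impI)
        fix c assume "c < snd d"
        then have "(fst d, c) \<in> \<Delta> \<longrightarrow> (fst d, c) \<in> \<Delta> - Gamma D"
          using \<open>d \<in> D\<close> \<Delta>(2) by (auto simp: Gamma_def removed_roots_eq)
        then show "Poly_Mapping.lookup g (fst d, c) = Poly_Mapping.lookup y (fst d, c)"
          using supportedD[OF g(1), of "(fst d, c)"] by (auto simp: y_def lookup_restr)
      qed
      have "agree d (g \<star> minv y) 0" if "d \<in> D" for d
        using agree_mmult[OF agree[OF that] minv_supported[OF y'(2)]] y' by (simp add: mmult_minv)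
      then have "g \<star> minv y \<in> ?H" using H_iff mcl g y' by auto
      moreover have "g = (g \<star> minv y) \<star> y" using g y' by (simp add: mmult_assoc minv_supported mmult_minv)
      ultimately show ?thesis using y by auto
    qed
  qed
  then obtain \<theta> e where
    real: "realization ?G (ind ?G ?H (char_module \<chi>)) (supported \<Delta>) (\<lambda>g x. x \<star> g) \<theta> ?R e"
    and eval: "\<forall>y\<in>?R. \<forall>x\<in>supported \<Delta>. \<theta> (e y) x = \<chi>0 (x \<star> inv\<^bsub>?G\<^esub> y)"
    by auto
  have eval': "\<theta> (e y) x = (\<Prod>d\<in>D. row_char d (f d) (x \<star> minv y))"
    if "y \<in> ?R" "x \<in> supported \<Delta>" for x y
    using eval that inv[of y] R\<Delta> by (simp add: \<chi>0_def subset_iff)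
  show ?thesis
    unfolding M by (intro exI[of _ \<theta>] exI[of _ e] conjI ballI real eval')
qed

text \<open>The roots of L are those inside an interval, and a middle index lies between the outer
  ones. Hence an entry of a product inside L involves only factors from L, while outside L the
  truncated factors contribute nothing by closedness.\<close>

lemma restr_L_mult:
  fixes x y :: "'l::linorder \<times> 'l \<Rightarrow>\<^sub>0 'r::ring_1"
  assumes "x \<in> supported Phi" "y \<in> supported Phi"
  shows "restr (L_roots d) (x \<star> y) = restr (L_roots d) x \<star> restr (L_roots d) y"
proof (rule poly_mapping_eqI)
  fix k :: "'l \<times> 'l"
  obtain a c where k: "k = (a, c)" by (cases k)
  obtain \<alpha> \<beta> where d: "d = (\<alpha>, \<beta>)" by (cases d)
  let ?x = "Poly_Mapping.lookup x" and ?y = "Poly_Mapping.lookup y"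
  let ?S = "{b \<in> snd ` Poly_Mapping.keys x. a < b \<and> b < c}"
  have lt: "a < b" if "?x (a, b) \<noteq> 0" for a b using supportedD[OF assms(1), of "(a, b)"] that by (auto simp: Phi_def)
  have lt': "a < b" if "?y (a, b) \<noteq> 0" for a b using supportedD[OF assms(2), of "(a, b)"] that by (auto simp: Phi_def)
  have 1: "Poly_Mapping.lookup (x \<star> y) (a, c) = ?x (a, c) + ?y (a, c) + (\<Sum>b\<in>?S. ?x (a, b) * ?y (b, c))"
    by (rule lookup_mmult) (auto intro: lookup_keys_image(2) lt lt')
  have 2: "Poly_Mapping.lookup (restr (L_roots d) x \<star> restr (L_roots d) y) (a, c) =
      Poly_Mapping.lookup (restr (L_roots d) x) (a, c) + Poly_Mapping.lookup (restr (L_roots d) y) (a, c) +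
      (\<Sum>b\<in>?S. Poly_Mapping.lookup (restr (L_roots d) x) (a, b) * Poly_Mapping.lookup (restr (L_roots d) y) (b, c))"
    by (rule lookup_mmult) (auto intro: lookup_keys_image(2) lt lt' simp: lookup_restr split: if_splits)
  show "Poly_Mapping.lookup (restr (L_roots d) (x \<star> y)) k =
      Poly_Mapping.lookup (restr (L_roots d) x \<star> restr (L_roots d) y) k"
  proof (cases "(a, c) \<in> L_roots d")
    case True
    then have "(a, b) \<in> L_roots d" "(b, c) \<in> L_roots d" if "b \<in> ?S" for b
      using that by (auto simp: L_roots_def d)
    then show ?thesis unfolding k 2 using True 1 by (simp add: lookup_restr)
  next
    case False
    have "Poly_Mapping.lookup (restr (L_roots d) x) (a, b) * Poly_Mapping.lookup (restr (L_roots d) y) (b, c) = 0" for b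
      using False closed_L_roots[of d] unfolding closed_roots_def by (auto simp: lookup_restr)
    then show ?thesis unfolding k 2 using False by (simp add: lookup_restr)
  qed
qed

lemma restr_supported: "x \<in> supported \<Delta> \<Longrightarrow> restr \<Delta> x = x"
  by (rule poly_mapping_eqI) (auto simp: lookup_restr dest: supportedD)

text \<open>The complement \<open>L\<close> is the image of the retraction \<open>restr (L_roots d)\<close> with kernel \<open>N\<close>.\<close>

lemma inflate_projection:
  fixes g :: "'l::linorder \<times> 'l \<Rightarrow>\<^sub>0 'r::ring_1"
  assumes g: "g \<in> supported Phi"
  shows "(THE l. l \<in> supported (L_roots d) \<and>
      (\<exists>n\<in>normal_closure McLain (\<Union>c\<in>N_roots d. root_subgroup c). g = n \<star> l)) = restr (L_roots d) g"
proof -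
  interpret group "McLain :: ('l \<times> 'l \<Rightarrow>\<^sub>0 'r) monoid" by (rule group_McLain)
  let ?\<pi> = "restr (L_roots d) :: ('l \<times> 'l \<Rightarrow>\<^sub>0 'r) \<Rightarrow> _"
  let ?S = "(\<Union>c\<in>N_roots d. root_subgroup c) :: ('l \<times> 'l \<Rightarrow>\<^sub>0 'r) set"
  let ?N = "normal_closure McLain ?S"
  have \<pi>_hom: "group_hom McLain McLain ?\<pi>"
  proof (intro group_hom.intro group_hom_axioms.intro is_group homI)
    show "?\<pi> x \<in> carrier McLain" if "x \<in> carrier McLain" for x
      using that by (auto simp: McLain_simps(1) supported_def keys_restr)
  qed (simp add: McLain_simps(1) restr_L_mult)
  have ker: "kernel McLain McLain ?\<pi> = supported (N_roots d)"
    by (auto simp: kernel_def McLain_simps(1,2) N_roots_eq supported_iff poly_mapping_eq_iff fun_eq_iff lookup_restr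
        split: if_splits)
  \<comment> \<open>The kernel of the retraction is a normal subgroup containing the generators of
    N.\<close>
  have N_le: "?N \<subseteq> supported (N_roots d)"
    using group_hom.normal_kernel[OF \<pi>_hom] unfolding normal_closure_def ker
    by (auto simp: root_subgroup_def)
  \<comment> \<open>Conversely, \<open>N_roots d\<close> is closed, so each element supported there
    is already a product of the generators.\<close>
  have le_N: "supported (N_roots d) \<subseteq> ?N"
  proof (unfold normal_closure_def, intro Inter_greatest, elim CollectE conjE)
    fix N assume N: "N \<lhd> (McLain :: ('l \<times> 'l \<Rightarrow>\<^sub>0 'r) monoid)" "?S \<subseteq> N"
    have "M_of (N_roots d) \<subseteq> N"
      unfolding M_of_def by (rule generate_subgroup_incl[OF N(2) normal_imp_subgroup[OF N(1)]])
    then show "supported (N_roots d) \<subseteq> N"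
      using M_of_eq_supported[OF closed_N_roots[of d], where 'r='r] by (auto simp: N_roots_eq)
  qed
  have \<pi>g: "?\<pi> g \<in> supported (L_roots d)" by (auto simp: supported_def keys_restr)
  have \<pi>g': "?\<pi> g \<in> supported Phi" using \<pi>g supported_mono[OF L_roots_subset] by blast
  have "?\<pi> (g \<star> minv (?\<pi> g)) = 0"
  proof -
    have "?\<pi> (g \<star> minv (?\<pi> g)) = ?\<pi> g \<star> ?\<pi> (minv (?\<pi> g))"
      by (rule restr_L_mult) (auto simp: g \<pi>g' minv_supported)
    also have "\<dots> = ?\<pi> g \<star> minv (?\<pi> (?\<pi> g))"
      using group_hom.hom_inv[OF \<pi>_hom, of "?\<pi> g"] \<pi>g' by (simp add: McLain_simps(1))
    finally show ?thesis using \<pi>g \<pi>g' by (simp add: restr_supported mmult_minv)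
  qed
  then have "g \<star> minv (?\<pi> g) \<in> ?N"
    using le_N ker g \<pi>g' mmult_supported minv_supported unfolding kernel_def McLain_simps(1,2) by blast
  moreover have "g = (g \<star> minv (?\<pi> g)) \<star> ?\<pi> g"
    using g \<pi>g' by (simp add: mmult_assoc minv_supported mmult_minv)
  \<comment> \<open>Applying the retraction to g = n l kills n and fixes l.\<close>
  moreover have "l = ?\<pi> g" if "l \<in> supported (L_roots d)" "n \<in> ?N" "g = n \<star> l" for l n
  proof -
    have "n \<in> kernel McLain McLain ?\<pi>" using that N_le ker by auto
    then have "?\<pi> n = 0" "n \<in> supported Phi" by (auto simp: kernel_def McLain_simps(1,2))
    moreover have "l \<in> supported Phi" using that supported_mono[OF L_roots_subset] by blast
    ultimately show ?thesis using that restr_L_mult[of n l d] by (simp add: restr_supported)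
  qed
  ultimately show ?thesis using \<pi>g by (intro the_equality) blast+
qed

text \<open>All roots in row \<open>fst d\<close> up to and including column \<open>snd d\<close>
  belong to L, so the projection keeps everything that \<open>row_char\<close> sees.\<close>

lemma row_char_restr_L:
  assumes "x \<in> supported Phi" "z \<in> supported Phi" "d \<in> Phi"
  shows "row_char d \<mu> (restr (L_roots d) x \<star> z) = row_char d \<mu> (x \<star> z)"
proof (rule row_char_cong_mmult)
  show "agree d (restr (L_roots d) x) x"
    unfolding agree_def
  proof (intro allI impI)
    fix c assume "c < snd d"
    then have "(fst d, c) \<in> L_roots d \<or> (fst d, c) \<notin> Phi" by (cases d) (auto simp: L_roots_def Phi_def)
    then show "Poly_Mapping.lookup (restr (L_roots d) x) (fst d, c) = Poly_Mapping.lookup x (fst d, c)"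
      using supportedD[OF assms(1)] by (auto simp: lookup_restr)
  qed
  show "Poly_Mapping.lookup (restr (L_roots d) x) d = Poly_Mapping.lookup x d"
    using assms(3) by (cases d) (auto simp: lookup_restr L_roots_def Phi_def)
qed fact

text \<open>Inflation from L to M leaves the formula of the functions unchanged, so the elementary
  module acquires the model of the module induced from H_i to M.\<close>

lemma elementary_realization:
  fixes \<mu> :: "'r::ring_1 \<Rightarrow> 'f::field" and d :: "'l::linorder \<times> 'l"
  assumes d: "d \<in> Phi" and \<mu>: "linear_character \<mu>"
  shows "\<exists>\<theta> e. realization McLain (elementary_module d \<mu>) (supported Phi) (\<lambda>g x. x \<star> g) \<theta>
      (supported (removed_roots d)) e \<and>
    (\<forall>y\<in>supported (removed_roots d). \<forall>x\<in>supported Phi. \<theta> (e y) x = row_char d \<mu> (x \<star> minv y))"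
proof -
  let ?\<Delta> = "L_roots d"
  have P: "?\<Delta> \<inter> Gamma {d} = P_roots d" by (simp add: P_roots_eq)
  have R: "?\<Delta> - Gamma {d} = removed_roots d"
    by (cases d) (auto simp: L_roots_def Gamma_def removed_roots_def Phi_def)
  have M: "M_of ?\<Delta> = (supported ?\<Delta> :: ('l \<times> 'l \<Rightarrow>\<^sub>0 'r) set)"
    by (rule M_of_eq_supported[OF closed_L_roots L_roots_subset])
  have \<chi>: "root_character (P_roots d) d \<mu> h = \<mu> (Poly_Mapping.lookup h d)" if "h \<in> supported (P_roots d)" for h
  proof (rule root_character_eq[OF \<mu>])
    show "closed_roots (P_roots d)"
      using closed_L_roots[of d] closed_Gamma[of "{d}"] unfolding P_roots_eq closed_roots_def by blast
    show "P_roots d \<subseteq> Phi" using L_roots_subset[of d] by (auto simp: P_roots_eq)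
    then have "supported (P_roots d) \<subseteq> supported Phi" by (rule supported_mono)
    then show "agree d x 0" if "x \<in> supported (P_roots d)" for x :: "'l \<times> 'l \<Rightarrow>\<^sub>0 'r"
      using that supported_Gamma_iff[of x "{d}"] supported_Int[of x "L_roots d" "Gamma {d}"] by (auto simp: P_roots_eq)
    show "d \<in> P_roots d" using d by (cases d) (auto simp: P_roots_def Phi_def)
  qed fact
  have "\<exists>\<theta> e. realization (McLain\<lparr>carrier := M_of ?\<Delta>\<rparr>)
      (ind (McLain\<lparr>carrier := M_of ?\<Delta>\<rparr>) (M_of (?\<Delta> \<inter> Gamma {d})) (char_module (root_character (P_roots d) d \<mu>)))
      (supported ?\<Delta>) (\<lambda>g x. x \<star> g) \<theta> (supported (?\<Delta> - Gamma {d})) e \<and>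
    (\<forall>y\<in>supported (?\<Delta> - Gamma {d}). \<forall>x\<in>supported ?\<Delta>. \<theta> (e y) x = (\<Prod>c\<in>{d}. row_char c \<mu> (x \<star> minv y)))"
    by (rule ind_McLain_realization) (auto simp: closed_L_roots L_roots_subset[THEN subsetD] \<mu> P \<chi>)
  then obtain \<theta> e where
    real: "realization (McLain\<lparr>carrier := supported ?\<Delta>\<rparr>)
      (ind (McLain\<lparr>carrier := supported ?\<Delta>\<rparr>) (M_of (P_roots d)) (char_module (root_character (P_roots d) d \<mu>)))
      (supported ?\<Delta>) (\<lambda>g x. x \<star> g) \<theta> (supported (removed_roots d)) e"
    and eval: "\<forall>y\<in>supported (removed_roots d). \<forall>x\<in>supported ?\<Delta>. \<theta> (e y) x = row_char d \<mu> (x \<star> minv y)"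
    unfolding P R M by auto
  have \<pi>L: "restr ?\<Delta> x \<in> supported ?\<Delta>" for x :: "'l \<times> 'l \<Rightarrow>\<^sub>0 'r" by (auto simp: supported_def keys_restr)
  have "realization McLain (elementary_module d \<mu>) (carrier McLain) (\<lambda>g x. x \<star> g)
      (\<lambda>v x. \<theta> v (restr ?\<Delta> x)) (supported (removed_roots d)) e"
    unfolding elementary_module_def M
    using real inflate_projection[of _ d] supported_mono[OF L_roots_subset[of d]]
    by (intro inflate_realization[OF group_McLain])
      (auto simp: McLain_simps(1) \<pi>L restr_supported restr_L_mult)
  moreover have "\<theta> (e y) (restr ?\<Delta> x) = row_char d \<mu> (x \<star> minv y)"
    if "y \<in> supported (removed_roots d)" "x \<in> supported Phi" for x y
  proof -
    have "y \<in> supported Phi" using that(1) supported_mono[of "removed_roots d" Phi] by (auto simp: removed_roots_eq)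
    then show ?thesis using that eval \<pi>L[of x] by (simp add: row_char_restr_L d minv_supported)
  qed
  ultimately show ?thesis unfolding McLain_simps(1) by (intro exI conjI) auto
qed

theorem theorem5p4:
  fixes D :: "('l::linorder \<times> 'l) set"
    and f :: "'l \<times> 'l \<Rightarrow> 'r::ring_1 \<Rightarrow> 'f::field"
  assumes "\<exists>\<mu> :: 'r \<Rightarrow> 'f. right_primitive \<mu>"
    and "basic D"
    and "\<And>d. d \<in> D \<Longrightarrow> right_primitive (f d)"
  shows "gmodule_iso McLain (basic_module D f) (ind McLain (M_of (Gamma D)) (W_module D f))"
proof -
  have D: "finite D" "D \<noteq> {}" "D \<subseteq> Phi" "inj_on fst D"
    using assms(2) by (auto simp: basic_def)
  have f: "linear_character (f d)" if "d \<in> D" for d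
    using assms(3)[OF that] by (simp add: right_primitive_def)
  let ?R = "supported (Phi - Gamma D) :: ('l \<times> 'l \<Rightarrow>\<^sub>0 'r) set"
  let ?Q = "\<lambda>d. supported (removed_roots d) :: ('l \<times> 'l \<Rightarrow>\<^sub>0 'r) set"
  let ?\<rho> = "\<lambda>d. restr (removed_roots d) :: ('l \<times> 'l \<Rightarrow>\<^sub>0 'r) \<Rightarrow> _"
  have Gamma_Phi: "Gamma D' \<subseteq> Phi" for D' :: "('l \<times> 'l) set" by (auto simp: Gamma_def)
  have QPhi: "y \<in> supported Phi" if "y \<in> ?Q d" for y d
    using that supported_mono[of "removed_roots d" Phi] by (auto simp: removed_roots_eq)
  have RPhi: "?R \<subseteq> supported Phi" by (rule supported_mono) auto
  have \<rho>Q: "?\<rho> d y \<in> ?Q d" for d y by (auto simp: supported_def keys_restr)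
  have R_roots: "Phi - Gamma D = (\<Union>d\<in>D. removed_roots d)" by (auto simp: Gamma_def removed_roots_eq)
  have \<rho>_agree: "agree d y (?\<rho> d y)" "Poly_Mapping.lookup y d = Poly_Mapping.lookup (?\<rho> d y) d"
    if "d \<in> D" "y \<in> ?R" for d y
  proof -
    show "agree d y (?\<rho> d y)"
      unfolding agree_def using supportedD[OF that(2)] that(1)
      by (auto simp: lookup_restr Gamma_def removed_roots_eq)
    \<comment> \<open>For c = d the strict column bound excludes \<open>d\<close>; for c \<noteq> d
      the distinct first indices do. Hence y and its truncated row both vanish at
      \<open>d\<close>.\<close>
    have "d \<notin> removed_roots c" if "c \<in> D" for c
      using that \<open>d \<in> D\<close> inj_onD[OF D(4), of c d] by (auto simp: removed_roots_eq)
    then have "d \<notin> Phi - Gamma D" unfolding R_roots by blast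
    then show "Poly_Mapping.lookup y d = Poly_Mapping.lookup (?\<rho> d y) d"
      using supportedD[OF that(2), of d] by (simp add: lookup_restr removed_roots_eq)
  qed
  have "\<forall>d\<in>D. \<exists>\<theta> e. realization McLain (elementary_module d (f d)) (supported Phi) (\<lambda>g x. x \<star> g) \<theta> (?Q d) e \<and>
    (\<forall>y\<in>?Q d. \<forall>x\<in>supported Phi. \<theta> (e y) x = row_char d (f d) (x \<star> minv y))"
    using D(3) f by (intro ballI elementary_realization) auto
  then obtain \<theta> e where
    real: "\<And>d. d \<in> D \<Longrightarrow> realization McLain (elementary_module d (f d)) (supported Phi) (\<lambda>g x. x \<star> g) (\<theta> d) (?Q d) (e d)"
    and eval: "\<And>d y x. d \<in> D \<Longrightarrow> y \<in> ?Q d \<Longrightarrow> x \<in> supported Phi \<Longrightarrow> \<theta> d (e d y) x = row_char d (f d) (x \<star> minv y)"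
    unfolding bchoice_iff by blast
  have "\<exists>\<theta>' e'. realization McLain (tensor D (\<lambda>d. elementary_module d (f d))) (supported Phi) (\<lambda>g x. x \<star> g) \<theta>' ?R e' \<and>
    (\<forall>y\<in>?R. \<forall>x\<in>supported Phi. \<theta>' (e' y) x = (\<Prod>d\<in>D. \<theta> d (e d (?\<rho> d y)) x))"
  proof (rule tensor_realization[OF D(1,2) real RPhi])
    show "y = y'" if "y \<in> ?R" "y' \<in> ?R" "\<And>d. d \<in> D \<Longrightarrow> ?\<rho> d y = ?\<rho> d y'" for y y'
    proof (rule poly_mapping_eqI)
      fix k
      show "Poly_Mapping.lookup y k = Poly_Mapping.lookup y' k"
      proof (cases "k \<in> Phi - Gamma D")
        case True
        then obtain d where "d \<in> D" "k \<in> removed_roots d" unfolding R_roots by blast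
        then show ?thesis using that(3)[of d] lookup_restr[of "removed_roots d"] by metis
      next
        case False
        then show ?thesis using that(1,2) supportedD by metis
      qed
    qed
    show "\<exists>y\<in>?R. \<forall>d\<in>D. ?\<rho> d y = s d" if s: "\<And>d. d \<in> D \<Longrightarrow> s d \<in> ?Q d" for s
    \<comment> \<open>Prescribed truncated rows are simply added up: distinct first indices put them
      in different rows, so they do not interfere.\<close>
    proof (intro bexI[of _ "\<Sum>d\<in>D. s d"] ballI poly_mapping_eqI)
      fix d k assume d: "d \<in> D"
      show "Poly_Mapping.lookup (?\<rho> d (\<Sum>d\<in>D. s d)) k = Poly_Mapping.lookup (s d) k"
      proof (cases "k \<in> removed_roots d")
        case True
        have "Poly_Mapping.lookup (s c) k = (if c = d then Poly_Mapping.lookup (s d) k else 0)" if "c \<in> D" for c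
        proof (cases "c = d")
          case False
          then have "k \<notin> removed_roots c"
            using True that d inj_onD[OF D(4), of c d] by (auto simp: removed_roots_eq)
          then show ?thesis using False supportedD[OF s[OF that]] by simp
        qed simp
        then have "(\<Sum>c\<in>D. Poly_Mapping.lookup (s c) k) =
            (\<Sum>c\<in>D. if c = d then Poly_Mapping.lookup (s d) k else 0)"
          by (rule sum.cong[OF refl])
        also have "\<dots> = Poly_Mapping.lookup (s d) k" using d D(1) by simp
        finally show ?thesis using True by (simp add: lookup_restr lookup_sum)
      next
        case False
        then show ?thesis using supportedD[OF s[OF d]] by (simp add: lookup_restr)
      qed
    next
      show "(\<Sum>d\<in>D. s d) \<in> ?R"
        using supportedD[OF s] unfolding supported_iff R_roots by (auto simp: lookup_sum intro!: sum.neutral)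
    qed
    show "\<theta> d (e d s) y = \<theta> d (e d s) (?\<rho> d y)" if "d \<in> D" "s \<in> ?Q d" "y \<in> ?R" for d s y
    proof -
      have y: "y \<in> supported Phi" using that(3) RPhi by blast
      show ?thesis
        unfolding eval[OF that(1,2) y] eval[OF that(1,2) QPhi[OF \<rho>Q]]
        by (rule row_char_cong_mmult[OF \<rho>_agree[OF that(1,3)] minv_supported[OF QPhi[OF that(2)]]])
    qed
  qed (assumption, rule \<rho>Q)
  then obtain \<theta>1 e1 where 1: "realization McLain (basic_module D f) (supported Phi) (\<lambda>g x. x \<star> g) \<theta>1 ?R e1"
    and eval1: "\<And>x y. x \<in> supported Phi \<Longrightarrow> y \<in> ?R \<Longrightarrow> \<theta>1 (e1 y) x = (\<Prod>d\<in>D. \<theta> d (e d (?\<rho> d y)) x)"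
    unfolding basic_module_def by blast
  have hat: "hat d (f d) h = f d (Poly_Mapping.lookup h d)" if "d \<in> D" "h \<in> supported (Gamma D)" for d h
  proof -
    have \<Gamma>: "Phi - removed_roots d = Gamma {d}" by (simp add: Gamma_def)
    show ?thesis
      unfolding hat_def \<Gamma>
    proof (rule root_character_eq[OF f[OF that(1)] closed_Gamma Gamma_Phi])
      show "d \<in> Gamma {d}" using that D(3) by (auto simp: Gamma_def removed_roots_eq)
      show "agree d x 0" if "x \<in> supported (Gamma {d})" for x :: "'l \<times> 'l \<Rightarrow>\<^sub>0 'r"
        using that supported_Gamma_iff[of x "{d}"] supported_mono[OF Gamma_Phi[of "{d}"]] by auto
      show "h \<in> supported (Gamma {d})"
        using that supported_mono[of "Gamma D" "Gamma {d}"] by (auto simp: Gamma_def)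
    qed
  qed
  have "\<exists>\<theta> e. realization (McLain\<lparr>carrier := M_of Phi\<rparr>)
      (ind (McLain\<lparr>carrier := M_of Phi\<rparr>) (M_of (Phi \<inter> Gamma D)) (char_module (\<lambda>h. \<Prod>d\<in>D. hat d (f d) h)))
      (supported Phi) (\<lambda>g x. x \<star> g) \<theta> ?R e \<and>
    (\<forall>y\<in>?R. \<forall>x\<in>supported Phi. \<theta> (e y) x = (\<Prod>d\<in>D. row_char d (f d) (x \<star> minv y)))"
    using D(1) f hat by (intro ind_McLain_realization closed_Phi) (auto simp: supported_Int intro!: prod.cong)
  moreover have "McLain\<lparr>carrier := M_of Phi\<rparr> = (McLain :: ('l \<times> 'l \<Rightarrow>\<^sub>0 'r) monoid)"
    unfolding M_of_eq_supported[OF closed_Phi order_refl] by (simp add: McLain_def J_eq)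
  moreover have "Phi \<inter> Gamma D = Gamma D" using Gamma_Phi by blast
  ultimately obtain \<theta>2 e2 where
    2: "realization McLain (ind McLain (M_of (Gamma D)) (W_module D f)) (supported Phi) (\<lambda>g x. x \<star> g) \<theta>2 ?R e2"
    and eval2: "\<And>x y. x \<in> supported Phi \<Longrightarrow> y \<in> ?R \<Longrightarrow> \<theta>2 (e2 y) x = (\<Prod>d\<in>D. row_char d (f d) (x \<star> minv y))"
    unfolding W_module_def by auto
  show ?thesis
  proof (rule realizations_iso[OF 1 2])
    fix x y :: "'l \<times> 'l \<Rightarrow>\<^sub>0 'r" assume x: "x \<in> supported Phi" and y: "y \<in> ?R"
    then have y': "y \<in> supported Phi" using RPhi by blast
    have "\<theta> d (e d (?\<rho> d y)) x = row_char d (f d) (x \<star> minv y)" if d: "d \<in> D" for d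
    proof -
      let ?y = "?\<rho> d y"
      \<comment> \<open>The correction between the two representatives: \<open>?h\<close> has zero
        truncated row and zero entry at \<open>d\<close>, so the character is 1 on it, and x y^{-1}
        \<open>?h\<close> is x times the inverse of \<open>?y\<close>.\<close>
      let ?h = "y \<star> minv ?y"
      have y'': "?y \<in> supported Phi" by (rule QPhi[OF \<rho>Q])
      note sup = x y' y'' minv_supported mmult_supported
      have h: "agree d ?h 0"
        using agree_mmult[OF \<rho>_agree(1)[OF d y] minv_supported[OF y'']] y'' by (simp add: mmult_minv)
      have "Poly_Mapping.lookup ?h d = 0"
        using lookup_mmult_diff[OF \<rho>_agree(1)[OF d y] minv_supported[OF y''], of "snd d"] \<rho>_agree(2)[OF d y] y''
        by (simp add: mmult_minv)
      then have "row_char d (f d) ((x \<star> minv y) \<star> ?h) = row_char d (f d) (x \<star> minv y)"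
        using row_char_mult[OF f[OF d] h, of "x \<star> minv y"] linear_character_zero[OF f[OF d]]
        by (simp add: sup)
      moreover have "(x \<star> minv y) \<star> ?h = x \<star> minv ?y"
      proof -
        have "(x \<star> minv y) \<star> ?h = x \<star> ((minv y \<star> y) \<star> minv ?y)"
          by (simp add: mmult_assoc sup)
        then show ?thesis using y' by (simp add: mmult_minv)
      qed
      ultimately show ?thesis using eval[OF d \<rho>Q x] by simp
    qed
    then show "\<theta>1 (e1 y) x = \<theta>2 (e2 y) x"
      using x y by (simp add: eval1 eval2)
  qed
qed

end
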